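(* Let $F:\mathcal{B}(\mathbb{R})\to\mathcal{L}_s^+(\mathcal{H})$ be a normalized POVM on a Hilbert space $\mathcal{H}$, let $(F,A,\mu)$ be a von Neumann triplet, and suppose that $A$ is a sharp version of $F$. Then there exists a set $\Gamma\subseteq\sigma(A)$ with $E^A(\Gamma)=\mathbf{1}$, where $E^A$ is the spectral measure of $A$, such that the family of functions $\{\mu_\Delta(\cdot)\}_{\Delta\in\mathcal{B}(\mathbb{R})}$ separates the points of $\Gamma$, i.e. for all $\lambda\neq\lambda'$ in $\Gamma$ there is $\Delta\in\mathcal{B}(\mathbb{R})$ with $\mu_\Delta(\lambda)\neq\mu_\Delta(\lambda')$.
   Context: $\mathcal{B}(\mathbb{R})$ is the Borel $\sigma$-algebra of $\mathbb{R}$; $\mathcal{L}_s^+(\mathcal{H})$ is the set of positive bounded self-adjoint operators on $\mathcal{H}$; $\mathbf{1}$ is the identity operator. A POVM (semispectral measure) is a map $F:\mathcal{B}(\mathbb{R})\to\mathcal{L}_s^+(\mathcal{H})$ with $F(\bigcup_n\Delta_n)=\sum_nF(\Delta_n)$ for every countable family of pairwise disjoint Borel sets, the series converging in the weak operator topology. It is normalized if $F(\mathbb{R})=\mathbf{1}$. For $\Lambda\subset\mathbb{R}$ and a spectral measure $E$ on $\mathcal{B}(\Lambda)$, a map $\mu:\Lambda\times\mathcal{B}(\mathbb{R})\to[0,1]$, $(\lambda,\Delta)\mapsto\mu_\Delta(\lambda)$, is a weak Markov kernel with respect to $E$ if $\mu_\Delta(\cdot)$ is Borel measurable for each $\Delta\in\mathcal{B}(\mathbb{R})$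 and, for each measure $\nu_x=\langle E(\cdot)x,x\rangle$, $x\in\mathcal{H}$: $0\le\mu_\Delta(\lambda)\le1$ $\nu_x$-a.e.; $\mu_{\mathbb{R}}(\lambda)=1$ and $\mu_\emptyset(\lambda)=0$ $\nu_x$-a.e.; and for every sequence of pairwise disjoint Borel sets $\Delta_i$, $\sum_i\mu_{\Delta_i}(\lambda)=\mu_{\cup_i\Delta_i}(\lambda)$ $\nu_x$-a.e. (the exceptional null set may depend on the sequence). A Markov kernel (for which $\mu_{(\cdot)}(\lambda)$ is a probability measure for every $\lambda$) is a special case. $(F,A,\mu)$ is a von Neumann triplet if $A$ is a self-adjoint operator, $\mu:\sigma(A)\times\mathcal{B}(\mathbb{R})\to[0,1]$ is a Markov kernel or a weak Markov kernel with respect to the spectral measure $E^A$ of $A$, and $F(\Delta)=\mu_\Delta(A)=\int_{\sigma(A)}\mu_\Delta(\lambda)\,dE^A_\lambda$ for every $\Delta\in\mathcal{B}(\mathbb{R})$. $A$ is a sharp version of $F$ if $A$ is bounded, $(F,A,\mu)$ is a von Neumann triplet for some $\mu$, and the von Neumann algebra generated by $A$ equals the von Neumann algebra generated by $\{F(\Delta):\Delta\in\mathcal{B}(\mathbb{R})\}$.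
   Formalization: The Hilbert space is assumed separable; for non-separable spaces the claim fails, e.g. for a diagonal operator on ℓ²([0,1]) built from a non-Borel set, where the only separating Γ of full spectral measure is not Borel. *)

theory Defs
  imports "HOL-Probability.Probability"
begin

section \<open>Complex Hilbert spaces\<close>

text \<open>
  A complex Hilbert space is introduced on top of the real Hilbert space with inner product
  \<open>Re \<langle>x, y\<rangle>\<close>, so that norm, topology and completeness are those of the library
  (\<open>norm x = sqrt (Re \<langle>x, x\<rangle>)\<close>, positive definiteness comes from \<^class>\<open>real_inner\<close>).
  The inner product is linear in the first argument.
\<close>

class complex_hilbert_space = real_inner + complete_space +
  fixes scaleC :: "complex \<Rightarrow> 'a \<Rightarrow> 'a"  (infixr "*\<^sub>C" 75)
    and cinner :: "'a \<Rightarrow> 'a \<Rightarrow> complex"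
  assumes scaleC_add_right: "c *\<^sub>C (x + y) = c *\<^sub>C x + c *\<^sub>C y"
    and scaleC_add_left: "(c + d) *\<^sub>C x = c *\<^sub>C x + d *\<^sub>C x"
    and scaleC_scaleC: "c *\<^sub>C (d *\<^sub>C x) = (c * d) *\<^sub>C x"
    and scaleC_of_real: "complex_of_real r *\<^sub>C x = r *\<^sub>R x"
    and cinner_add_left: "cinner (x + y) z = cinner x z + cinner y z"
    and cinner_scaleC_left: "cinner (c *\<^sub>C x) y = c * cinner x y"
    and cinner_commute: "cinner x y = cnj (cinner y x)"
    and Re_cinner: "Re (cinner x y) = inner x y"

instantiation complex :: complex_hilbert_space
begin

definition scaleC_complex :: "complex \<Rightarrow> complex \<Rightarrow> complex" where
  "scaleC_complex c x = c * x"

definition cinner_complex :: "complex \<Rightarrow> complex \<Rightarrow> complex" where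
  "cinner_complex x y = x * cnj y"

instance
  by standard (auto simp: scaleC_complex_def cinner_complex_def algebra_simps
      scaleR_conv_of_real inner_complex_def)

end


section \<open>Bounded operators and von Neumann algebras\<close>

definition bounded_clinear :: "('a::complex_hilbert_space \<Rightarrow> 'a) \<Rightarrow> bool" where
  "bounded_clinear T \<longleftrightarrow> bounded_linear T \<and> (\<forall>c x. T (c *\<^sub>C x) = c *\<^sub>C T x)"

definition adjoint_pair :: "('a::complex_hilbert_space \<Rightarrow> 'a) \<Rightarrow> ('a \<Rightarrow> 'a) \<Rightarrow> bool" where
  "adjoint_pair S T \<longleftrightarrow> (\<forall>x y. cinner (S x) y = cinner x (T y))"

text \<open>
  \<open>0 \<le> Re \<dots>\<close> suffices for positivity, as \<open>\<langle>T x, x\<rangle>\<close> is real for self-adjoint \<open>T\<close>.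
\<close>

definition positive_operator :: "('a::complex_hilbert_space \<Rightarrow> 'a) \<Rightarrow> bool" where
  "positive_operator T \<longleftrightarrow>
     bounded_clinear T \<and> adjoint_pair T T \<and> (\<forall>x. 0 \<le> Re (cinner (T x) x))"

text \<open>
  The finite sets \<open>P\<close> and the numbers \<open>\<epsilon>\<close> index the basic neighbourhoods of \<open>T\<close> in the weak
  operator topology.
\<close>

definition wot_closure :: "('a::complex_hilbert_space \<Rightarrow> 'a) set \<Rightarrow> ('a \<Rightarrow> 'a) set" where
  "wot_closure N = {T. bounded_clinear T \<and>
     (\<forall>P \<epsilon>. finite P \<longrightarrow> \<epsilon> > 0 \<longrightarrow>
        (\<exists>S\<in>N. \<forall>(x, y)\<in>P. cmod (cinner (S x) y - cinner (T x) y) < \<epsilon>))}"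

definition von_neumann_algebra :: "('a::complex_hilbert_space \<Rightarrow> 'a) set \<Rightarrow> bool" where
  "von_neumann_algebra N \<longleftrightarrow>
     (\<forall>T\<in>N. bounded_clinear T) \<and>
     (\<lambda>x. x) \<in> N \<and>
     (\<forall>S\<in>N. \<forall>T\<in>N. (\<lambda>x. S x + T x) \<in> N) \<and>
     (\<forall>c. \<forall>T\<in>N. (\<lambda>x. c *\<^sub>C T x) \<in> N) \<and>
     (\<forall>S\<in>N. \<forall>T\<in>N. (\<lambda>x. S (T x)) \<in> N) \<and>
     (\<forall>S\<in>N. \<forall>T. bounded_clinear T \<and> adjoint_pair S T \<longrightarrow> T \<in> N) \<and>
     wot_closure N \<subseteq> N"

definition generated_von_neumann_algebra ::
    "('a::complex_hilbert_space \<Rightarrow> 'a) set \<Rightarrow> ('a \<Rightarrow> 'a) set" where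
  "generated_von_neumann_algebra G = \<Inter>{N. von_neumann_algebra N \<and> G \<subseteq> N}"


section \<open>Self-adjoint operators and their spectrum\<close>

text \<open>
  A possibly unbounded operator is a partial map with domain \<^term>\<open>dom A\<close>.
\<close>

definition linear_operator :: "('a::complex_hilbert_space \<rightharpoonup> 'a) \<Rightarrow> bool" where
  "linear_operator A \<longleftrightarrow>
     A 0 = Some 0 \<and>
     (\<forall>x y v w. A x = Some v \<longrightarrow> A y = Some w \<longrightarrow> A (x + y) = Some (v + w)) \<and>
     (\<forall>c x v. A x = Some v \<longrightarrow> A (c *\<^sub>C x) = Some (c *\<^sub>C v))"

definition adjoint_graph :: "('a::complex_hilbert_space \<rightharpoonup> 'a) \<Rightarrow> ('a \<times> 'a) set" where
  "adjoint_graph A = {(y, z). \<forall>(x, w)\<in>Map.graph A. cinner w y = cinner x z}"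

definition self_adjoint_operator :: "('a::complex_hilbert_space \<rightharpoonup> 'a) \<Rightarrow> bool" where
  "self_adjoint_operator A \<longleftrightarrow>
     linear_operator A \<and> closure (dom A) = UNIV \<and> Map.graph A = adjoint_graph A"

definition bounded_inverse ::
    "('a::complex_hilbert_space \<rightharpoonup> 'a) \<Rightarrow> complex \<Rightarrow> ('a \<Rightarrow> 'a) \<Rightarrow> bool" where
  "bounded_inverse A z R \<longleftrightarrow>
     bounded_clinear R \<and>
     (\<forall>y. \<exists>w. A (R y) = Some w \<and> w - z *\<^sub>C R y = y) \<and>
     (\<forall>x w. A x = Some w \<longrightarrow> R (w - z *\<^sub>C x) = x)"

definition operator_spectrum :: "('a::complex_hilbert_space \<rightharpoonup> 'a) \<Rightarrow> complex set" where
  "operator_spectrum A = {z. \<nexists>R. bounded_inverse A z R}"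

text \<open>
  The spectrum of a self-adjoint operator is real; it is used as a set of real numbers.
\<close>

definition real_spectrum :: "('a::complex_hilbert_space \<rightharpoonup> 'a) \<Rightarrow> real set" where
  "real_spectrum A = {t. complex_of_real t \<in> operator_spectrum A}"


section \<open>POVMs and spectral measures\<close>

text \<open>
  In the following, only the carrier and the sigma-algebra of the measure space \<open>M\<close> matter.
  Finite families are covered by sequences that are eventually empty.
\<close>

definition povm :: "'b measure \<Rightarrow> ('b set \<Rightarrow> 'a::complex_hilbert_space \<Rightarrow> 'a) \<Rightarrow> bool" where
  "povm M F \<longleftrightarrow>
     (\<forall>\<Delta>\<in>sets M. positive_operator (F \<Delta>)) \<and>
     (\<forall>\<Delta>::nat \<Rightarrow> 'b set. range \<Delta> \<subseteq> sets M \<longrightarrow> disjoint_family \<Delta> \<longrightarrow>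
        (\<forall>x y. (\<lambda>n. cinner (F (\<Delta> n) x) y) sums cinner (F (\<Union>n. \<Delta> n) x) y))"

definition normalized_povm ::
    "'b measure \<Rightarrow> ('b set \<Rightarrow> 'a::complex_hilbert_space \<Rightarrow> 'a) \<Rightarrow> bool" where
  "normalized_povm M F \<longleftrightarrow> povm M F \<and> F (space M) = (\<lambda>x. x)"

definition spectral_measure ::
    "'b measure \<Rightarrow> ('b set \<Rightarrow> 'a::complex_hilbert_space \<Rightarrow> 'a) \<Rightarrow> bool" where
  "spectral_measure M E \<longleftrightarrow>
     normalized_povm M E \<and> (\<forall>\<Delta>\<in>sets M. \<forall>x. E \<Delta> (E \<Delta> x) = E \<Delta> x)"

text \<open>The measure \<open>\<nu>\<^sub>x = \<langle>E(\<cdot>) x, x\<rangle>\<close>.\<close>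

definition scalar_measure ::
    "'b measure \<Rightarrow> ('b set \<Rightarrow> 'a::complex_hilbert_space \<Rightarrow> 'a) \<Rightarrow> 'a \<Rightarrow> 'b measure" where
  "scalar_measure M E x =
     measure_of (space M) (sets M) (\<lambda>\<Delta>. ennreal (Re (cinner (E \<Delta> x) x)))"

lemma sets_scalar_measure [simp]: "sets (scalar_measure M E x) = sets M"
  and space_scalar_measure [simp]: "space (scalar_measure M E x) = space M"
  by (simp_all add: scalar_measure_def)

lemma emeasure_scalar_measure:
  assumes "povm M E" and "\<Delta> \<in> sets M"
  shows "emeasure (scalar_measure M E x) \<Delta> = ennreal (Re (cinner (E \<Delta> x) x))"
  unfolding scalar_measure_def
proof (rule emeasure_measure_of_sigma)
  have nonneg: "0 \<le> Re (cinner (E S x) x)" if "S \<in> sets M" for S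
    using assms(1) that by (simp add: povm_def positive_operator_def)
  have sums: "(\<lambda>n. Re (cinner (E (D n) x) x)) sums Re (cinner (E (\<Union>n. D n) x) x)"
    if "range D \<subseteq> sets M" "disjoint_family D" for D :: "nat \<Rightarrow> 'a set"
    using assms(1) that by (intro sums_Re) (simp add: povm_def)
  show "sigma_algebra (space M) (sets M)" ..
  show "positive (sets M) (\<lambda>\<Delta>. ennreal (Re (cinner (E \<Delta> x) x)))"
  proof -
    have "(\<lambda>n::nat. Re (cinner (E {} x) x)) sums Re (cinner (E {} x) x)"
      using sums[of "\<lambda>_. {}"] by (simp add: disjoint_family_on_def)
    then have "summable (\<lambda>n::nat. Re (cinner (E {} x) x))"
      by (rule sums_summable)
    then have "Re (cinner (E {} x) x) = 0"
      by (simp add: summable_const_iff)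
    then show ?thesis by (simp add: positive_def)
  qed
  show "countably_additive (sets M) (\<lambda>\<Delta>. ennreal (Re (cinner (E \<Delta> x) x)))"
  proof (rule countably_additiveI)
    fix D :: "nat \<Rightarrow> 'a set"
    assume D: "range D \<subseteq> sets M" "disjoint_family D"
    have "(\<Sum>n. ennreal (Re (cinner (E (D n) x) x))) = ennreal (\<Sum>n. Re (cinner (E (D n) x) x))"
      using D(1) by (intro suminf_ennreal2 nonneg sums_summable[OF sums[OF D]]) auto
    then show "(\<Sum>n. ennreal (Re (cinner (E (D n) x) x))) = ennreal (Re (cinner (E (\<Union>n. D n) x) x))"
      using sums_unique[OF sums[OF D]] by simp
  qed
qed (use assms in simp)

text \<open>
  \<open>B = \<integral> f dE\<close> for a real measurable function \<open>f\<close>: the linear operator with domain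
  \<open>{x. \<integral> f\<^sup>2 d\<nu>\<^sub>x < \<infinity>}\<close> and quadratic form \<open>\<langle>B x, x\<rangle> = \<integral> f d\<nu>\<^sub>x\<close>; by polarization the form
  determines \<open>B\<close>. For bounded \<open>f\<close> the domain is the whole space.
\<close>

definition is_spectral_integral ::
    "'b measure \<Rightarrow> ('b set \<Rightarrow> 'a::complex_hilbert_space \<Rightarrow> 'a) \<Rightarrow> ('b \<Rightarrow> real) \<Rightarrow> ('a \<rightharpoonup> 'a) \<Rightarrow> bool"
  where
  "is_spectral_integral M E f B \<longleftrightarrow>
     linear_operator B \<and>
     dom B = {x. integrable (scalar_measure M E x) (\<lambda>t. (f t)\<^sup>2)} \<and>
     (\<forall>x v. B x = Some v \<longrightarrow>
        cinner v x = complex_of_real (integral\<^sup>L (scalar_measure M E x) f))"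

abbreviation spectrum_space :: "('a::complex_hilbert_space \<rightharpoonup> 'a) \<Rightarrow> real measure" where
  "spectrum_space A \<equiv> restrict_space borel (real_spectrum A)"

text \<open>
  \<open>E = E\<^sup>A\<close>, the spectral measure on the Borel sets of the spectrum of \<open>A\<close> for which
  \<open>A = \<integral> t dE(t)\<close>. By the spectral theorem it exists and is unique for self-adjoint \<open>A\<close>.
\<close>

definition spectral_measure_of ::
    "('a::complex_hilbert_space \<rightharpoonup> 'a) \<Rightarrow> (real set \<Rightarrow> 'a \<Rightarrow> 'a) \<Rightarrow> bool" where
  "spectral_measure_of A E \<longleftrightarrow>
     spectral_measure (spectrum_space A) E \<and>
     is_spectral_integral (spectrum_space A) E (\<lambda>t. t) A"


section \<open>Markov kernels, von Neumann triplets and sharp versions\<close>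

text \<open>
  Kernels are written \<open>\<mu> \<Delta> t\<close> for \<open>\<mu>\<^sub>\<Delta>(t)\<close>; only the values at \<open>t \<in> \<Lambda>\<close> and Borel \<open>\<Delta>\<close> matter.
\<close>

definition kernel_map :: "real set \<Rightarrow> (real set \<Rightarrow> real \<Rightarrow> real) \<Rightarrow> bool" where
  "kernel_map \<Lambda> \<mu> \<longleftrightarrow>
     (\<forall>\<Delta>\<in>sets borel. \<mu> \<Delta> \<in> borel_measurable (restrict_space borel \<Lambda>) \<and>
        (\<forall>t\<in>\<Lambda>. 0 \<le> \<mu> \<Delta> t \<and> \<mu> \<Delta> t \<le> 1))"

definition markov_kernel :: "real set \<Rightarrow> (real set \<Rightarrow> real \<Rightarrow> real) \<Rightarrow> bool" where
  "markov_kernel \<Lambda> \<mu> \<longleftrightarrow>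
     kernel_map \<Lambda> \<mu> \<and>
     (\<forall>t\<in>\<Lambda>. \<exists>P. prob_space P \<and> sets P = sets borel \<and> (\<forall>\<Delta>\<in>sets borel. \<mu> \<Delta> t = measure P \<Delta>))"

text \<open>
  The requirement \<open>0 \<le> \<mu>\<^sub>\<Delta>(t) \<le> 1\<close> for almost every \<open>t\<close> is subsumed by the codomain \<open>[0, 1]\<close>
  in \<^const>\<open>kernel_map\<close>.
\<close>

definition weak_markov_kernel ::
    "real set \<Rightarrow> (real set \<Rightarrow> 'a::complex_hilbert_space \<Rightarrow> 'a) \<Rightarrow> (real set \<Rightarrow> real \<Rightarrow> real) \<Rightarrow> bool"
  where
  "weak_markov_kernel \<Lambda> E \<mu> \<longleftrightarrow>
     kernel_map \<Lambda> \<mu> \<and>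
     (\<forall>x. let \<nu> = scalar_measure (restrict_space borel \<Lambda>) E x in
        (AE t in \<nu>. \<mu> UNIV t = 1) \<and>
        (AE t in \<nu>. \<mu> {} t = 0) \<and>
        (\<forall>\<Delta>::nat \<Rightarrow> real set. range \<Delta> \<subseteq> sets borel \<longrightarrow> disjoint_family \<Delta> \<longrightarrow>
           (AE t in \<nu>. (\<lambda>i. \<mu> (\<Delta> i) t) sums \<mu> (\<Union>i. \<Delta> i) t)))"

definition von_neumann_triplet ::
    "(real set \<Rightarrow> 'a::complex_hilbert_space \<Rightarrow> 'a) \<Rightarrow> ('a \<rightharpoonup> 'a) \<Rightarrow> (real set \<Rightarrow> real \<Rightarrow> real) \<Rightarrow> bool"
  where
  "von_neumann_triplet F A \<mu> \<longleftrightarrow>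
     self_adjoint_operator A \<and>
     (\<exists>E. spectral_measure_of A E \<and>
        (markov_kernel (real_spectrum A) \<mu> \<or> weak_markov_kernel (real_spectrum A) E \<mu>) \<and>
        (\<forall>\<Delta>\<in>sets borel. is_spectral_integral (spectrum_space A) E (\<mu> \<Delta>) (\<lambda>x. Some (F \<Delta> x))))"

definition sharp_version ::
    "('a::complex_hilbert_space \<rightharpoonup> 'a) \<Rightarrow> (real set \<Rightarrow> 'a \<Rightarrow> 'a) \<Rightarrow> bool" where
  "sharp_version A F \<longleftrightarrow>
     (\<exists>T. bounded_clinear T \<and> A = (\<lambda>x. Some (T x)) \<and>
        (\<exists>\<mu>. von_neumann_triplet F A \<mu>) \<and>
        generated_von_neumann_algebra {T} = generated_von_neumann_algebra (F ` sets borel))"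

end

theory Submission
  imports Defs
begin

text \<open>
  By uniqueness of the spectral measure all kernels may be taken with respect to \<open>E\<close>. Let \<open>G\<close> be
  the sigma-algebra on the spectrum generated by the functions \<open>\<mu> \<Delta>\<close>. The weakly closed linear span
  of the projections \<open>E B\<close>, \<open>B\<close> in \<open>G\<close>, is a von Neumann algebra containing all \<open>F \<Delta>\<close>, hence, as
  \<open>A\<close> is sharp, it contains \<open>A\<close>. A conditional expectation argument shows that the identity function
  of the spectrum then agrees almost everywhere with a \<open>G\<close>-measurable function \<open>g\<close>. A \<open>G\<close>-measurable
  function takes the same value at points that no \<open>\<mu> \<Delta>\<close> separates, so \<open>\<Gamma>\<close> can be the set
  where \<open>g\<close> equals the identity.

  In place of a functional calculus, \<open>\<integral> h dE\<close> for \<open>0 \<le> h \<le> 1\<close> is written as the norm convergent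
  series \<open>\<Sum>k. (1/2)\<^sup>k\<^sup>+\<^sup>1 E B\<^sub>k\<close> with \<open>B\<^sub>k\<close> the set where the \<open>k\<close>-th binary digit of \<open>h\<close> is 1.
\<close>

section \<open>Complex inner product\<close>

lemma scaleC_scaleR: "c *\<^sub>C (r *\<^sub>R x) = r *\<^sub>R (c *\<^sub>C (x::'a::complex_hilbert_space))"
  by (metis scaleC_of_real scaleC_scaleC mult.commute)

lemma scaleC_minus_right: "c *\<^sub>C (- x) = - (c *\<^sub>C (x::'a::complex_hilbert_space))"
  using scaleC_scaleR[of c "-1" x] by simp

lemma scaleC_diff_right: "c *\<^sub>C (x - y) = c *\<^sub>C x - c *\<^sub>C (y::'a::complex_hilbert_space)"
  using scaleC_add_right[of c x "- y"] by (simp add: scaleC_minus_right)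

lemma cinner_add_right: "cinner x (y + z) = cinner x y + cinner (x::'a::complex_hilbert_space) z"
  by (metis cinner_add_left cinner_commute complex_cnj_add)

lemma cinner_scaleC_right: "cinner x (c *\<^sub>C y) = cnj c * cinner (x::'a::complex_hilbert_space) y"
  by (metis cinner_commute cinner_scaleC_left complex_cnj_mult)

lemma cinner_scaleR_left: "cinner (r *\<^sub>R x) y = of_real r * cinner (x::'a::complex_hilbert_space) y"
  by (metis cinner_scaleC_left scaleC_of_real)

lemma cinner_scaleR_right: "cinner x (r *\<^sub>R y) = of_real r * cinner (x::'a::complex_hilbert_space) y"
  by (metis cinner_scaleC_right complex_cnj_complex_of_real scaleC_of_real)

lemma cinner_zero_left [simp]: "cinner 0 (y::'a::complex_hilbert_space) = 0"
  using cinner_scaleR_left[of 0 y y] by simp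

lemma cinner_minus_left: "cinner (- x) y = - cinner (x::'a::complex_hilbert_space) y"
  using cinner_scaleR_left[of "-1" x y] by simp

lemma cinner_diff_left: "cinner (x - y) z = cinner x z - cinner (y::'a::complex_hilbert_space) z"
  using cinner_add_left[of x "- y" z] by (simp add: cinner_minus_left)

lemma cinner_self: "cinner x x = of_real ((norm (x::'a::complex_hilbert_space))\<^sup>2)"
proof -
  have "Im (cinner x x) = 0"
    using arg_cong[OF cinner_commute[of x x], of Im] by simp
  then show ?thesis
    by (simp add: complex_eq_iff Re_cinner power2_norm_eq_inner)
qed

text \<open>Reduces the complex inner product to the real one, so that its continuity follows from
  the library facts on \<open>inner\<close>.\<close>

lemma cinner_eq_inner:
  "cinner x y = of_real (inner x y) + \<i> * of_real (inner ((-\<i>) *\<^sub>C x) (y::'a::complex_hilbert_space))"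
proof -
  have "inner ((-\<i>) *\<^sub>C x) y = Im (cinner x y)"
    using Re_cinner[of "(-\<i>) *\<^sub>C x" y] by (simp add: cinner_scaleC_left)
  then show ?thesis
    by (simp add: complex_eq_iff Re_cinner)
qed

lemma bounded_linear_cinner_right: "bounded_linear (cinner (x::'a::complex_hilbert_space))"
proof -
  have "bounded_linear (\<lambda>y. of_real (inner x y) + \<i> * of_real (inner ((-\<i>) *\<^sub>C x) y))"
    by (intro bounded_linear_add bounded_linear_const_mult
        bounded_linear_compose[OF bounded_linear_of_real] bounded_linear_inner_right)
  then show ?thesis
    by (simp add: cinner_eq_inner[abs_def])
qed

lemma bounded_linear_cinner_left: "bounded_linear (\<lambda>x. cinner (x::'a::complex_hilbert_space) y)"
  using bounded_linear_compose[OF bounded_linear_cnj bounded_linear_cinner_right[of y]]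
  by (simp flip: cinner_commute)

lemma cinner_left_eqI:
  assumes "\<And>y. cinner x y = cinner x' (y::'a::complex_hilbert_space)" shows "x = x'"
proof -
  have "cinner (x - x') (x - x') = 0"
    by (simp add: cinner_diff_left assms)
  then show ?thesis
    by (simp add: cinner_self)
qed

lemma norm_scaleC: "norm (c *\<^sub>C x) = cmod c * norm (x::'a::complex_hilbert_space)"
proof -
  have "cinner (c *\<^sub>C x) (c *\<^sub>C x) = (c * cnj c) * cinner x x"
    by (simp add: cinner_scaleC_left cinner_scaleC_right)
  also have "c * cnj c = of_real ((cmod c)\<^sup>2)"
    by (simp add: complex_norm_square del: of_real_power)
  finally have "complex_of_real ((norm (c *\<^sub>C x))\<^sup>2) = of_real ((cmod c * norm x)\<^sup>2)"
    unfolding cinner_self by (simp only: power_mult_distrib of_real_mult)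
  then have "(norm (c *\<^sub>C x))\<^sup>2 = (cmod c * norm x)\<^sup>2"
    by (simp only: of_real_eq_iff)
  then show ?thesis by (simp add: power2_eq_iff_nonneg)
qed

lemma bounded_linear_scaleC_right: "bounded_linear (\<lambda>x. c *\<^sub>C (x::'a::complex_hilbert_space))"
  by (rule bounded_linear_intro[where K = "cmod c"])
    (auto simp: scaleC_add_right scaleC_scaleR norm_scaleC mult.commute)

text \<open>Expanding the form at \<open>x + y\<close> and at \<open>x + \<i> y\<close> shows that
  both the sum and the difference of the two cross terms vanish. Complex scalars are essential here:
  a real rotation by a right angle has zero form.\<close>

lemma polarization_zero:
  fixes S :: "'a::complex_hilbert_space \<Rightarrow> 'a"
  assumes add: "\<And>x y. S (x + y) = S x + S y"
    and scale: "\<And>c x. S (c *\<^sub>C x) = c *\<^sub>C S x"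
    and form: "\<And>x. cinner (S x) x = 0"
  shows "S x = 0"
proof (rule cinner_left_eqI)
  fix y
  have "cinner (S x) y + cinner (S y) x = 0"
    using form[of "x + y"] by (simp add: add cinner_add_left cinner_add_right form add.commute)
  moreover have "- (\<i> * cinner (S x) y) + \<i> * cinner (S y) x = 0"
    using form[of "x + \<i> *\<^sub>C y"]
    by (simp add: add scale cinner_add_left cinner_add_right form cinner_scaleC_left
        cinner_scaleC_right)
  then have "\<i> * (cinner (S y) x - cinner (S x) y) = 0"
    by (simp add: algebra_simps)
  then have "cinner (S y) x = cinner (S x) y"
    by simp
  ultimately show "cinner (S x) y = cinner 0 y"
    by simp
qed

text \<open>Spectral integrals are specified by their quadratic forms only; this turns equal forms
  into equal operators.\<close>

lemma polarization_eq:
  fixes S T :: "'a::complex_hilbert_space \<Rightarrow> 'a"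
  assumes "\<And>x y. S (x + y) = S x + S y" "\<And>c x. S (c *\<^sub>C x) = c *\<^sub>C S x"
    and "\<And>x y. T (x + y) = T x + T y" "\<And>c x. T (c *\<^sub>C x) = c *\<^sub>C T x"
    and "\<And>x. cinner (S x) x = cinner (T x) x"
  shows "S x = T x"
  using polarization_zero[of "\<lambda>x. S x - T x" x] assms
  by (simp add: scaleC_diff_right cinner_diff_left)

lemma bounded_clinearD:
  assumes "bounded_clinear S"
  shows "bounded_linear S" "S (x + y) = S x + S y" "S (x - y) = S x - S y"
    "S (c *\<^sub>C x) = c *\<^sub>C S x" "S (r *\<^sub>R x) = r *\<^sub>R S x" "S (- x) = - S x" "S 0 = 0"
proof -
  from assms have S: "bounded_linear S" and scale: "S (c *\<^sub>C x) = c *\<^sub>C S x"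
    by (auto simp: bounded_clinear_def)
  show "bounded_linear S" "S (c *\<^sub>C x) = c *\<^sub>C S x" by fact+
  show "S (x + y) = S x + S y" "S (x - y) = S x - S y" "S (r *\<^sub>R x) = r *\<^sub>R S x"
    "S (- x) = - S x" "S 0 = 0"
    using linear_simps[OF S] by (auto simp: linear_0[OF bounded_linear.linear[OF S]])
qed

section \<open>Dyadic expansions\<close>

text \<open>The binary digits of \<^term>\<open>h\<close>, computed greedily so that the value 1 is not excluded.\<close>

lemma binary_digit_sets:
  fixes h :: "'b \<Rightarrow> real"
  assumes meas [measurable]: "h \<in> borel_measurable M"
    and range: "\<And>t. t \<in> space M \<Longrightarrow> 0 \<le> h t \<and> h t \<le> 1"
  obtains B where "range B \<subseteq> sets M"
    "\<And>t. t \<in> space M \<Longrightarrow> (\<lambda>k. (1/2)^Suc k * indicator (B k) t) sums h t"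
proof -
  \<comment> \<open>\<open>r k\<close> is the remainder after \<open>k\<close> digits. The invariant
    is \<open>0 \<le> r k t \<le> (1/2)^k\<close> with both ends included, which is why the digit
    test is \<open>\<ge>\<close>.\<close>
  define r :: "nat \<Rightarrow> 'b \<Rightarrow> real" where
    "r = rec_nat h (\<lambda>k s t. s t - (if s t \<ge> (1/2)^Suc k then (1/2)^Suc k else 0))"
  have r0: "r 0 = h" and rS: "r (Suc k) t = r k t - (if r k t \<ge> (1/2)^Suc k then (1/2)^Suc k else 0)"
    for k t by (auto simp: r_def)
  have [measurable]: "r k \<in> borel_measurable M" for k
  proof (induction k)
    case (Suc k)
    then have [measurable]: "r k \<in> borel_measurable M" .
    show ?case unfolding rS[abs_def] by measurable
  qed (simp add: r0)
  define B where "B k = {t \<in> space M. r k t \<ge> (1/2)^Suc k}" for k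
  have "B k \<in> sets M" for k unfolding B_def by measurable
  then have B: "range B \<subseteq> sets M" by auto
  have "(\<lambda>k. (1/2)^Suc k * indicator (B k) t) sums h t" if t: "t \<in> space M" for t
  proof -
    have bound: "0 \<le> r k t \<and> r k t \<le> (1/2)^k" for k
      by (induction k) (use range[OF t] in \<open>auto simp: r0 rS\<close>)
    have partial: "(\<Sum>k<n. (1/2)^Suc k * indicator (B k) t) = h t - r n t" for n
      by (induction n) (use t in \<open>auto simp: r0 rS B_def\<close>)
    have "(\<lambda>n. r n t) \<longlonglongrightarrow> 0"
      by (rule tendsto_sandwich[of "\<lambda>_. 0" _ _ "\<lambda>n. (1/2::real)^n"])
        (use bound in \<open>auto intro!: always_eventually LIMSEQ_realpow_zero\<close>)
    then have "(\<lambda>n. h t - r n t) \<longlonglongrightarrow> h t - 0"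
      by (intro tendsto_intros)
    then show ?thesis
      by (simp add: sums_def partial del: power_Suc)
  qed
  with B that show ?thesis by blast
qed

text \<open>Termwise integration, justified by the geometric majorant
  \<open>(1/2)^Suc k * \<bar>f t\<bar>\<close>. Integrals against \<open>h\<close> thereby reduce to
  integrals over its digit sets.\<close>

lemma dyadic_integral_sums:
  fixes h f :: "'b \<Rightarrow> real"
  assumes B: "range B \<subseteq> sets N" and N: "finite_measure N"
    and h: "\<And>t. t \<in> space N \<Longrightarrow> (\<lambda>k. (1/2)^Suc k * indicator (B k) t) sums h t"
    and f: "integrable N f"
  shows "(\<lambda>k. (1/2)^Suc k * (\<integral>t. indicator (B k) t * f t \<partial>N)) sums (\<integral>t. h t * f t \<partial>N)"
proof -
  let ?u = "\<lambda>k t. (1/2)^Suc k * (indicator (B k) t * f t)"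
  have int: "integrable N (\<lambda>t. indicator (B k) t * f t)" for k
    using integrable_mult_indicator[of "B k" N f] B f by auto
  have geo: "summable (\<lambda>k. (1/2::real)^Suc k * c)" for c
    by (intro summable_mult2) (simp add: summable_geometric)
  have *: "(\<lambda>k. integral\<^sup>L N (?u k)) sums (\<integral>t. (\<Sum>k. ?u k t) \<partial>N)"
  proof (rule sums_integral)
    show "integrable N (?u k)" for k
      using int by (intro integrable_mult_right)
    show "AE t in N. summable (\<lambda>k. norm (?u k t))"
    proof (rule AE_I2)
      fix t
      show "summable (\<lambda>k. norm (?u k t))"
        by (rule summable_comparison_test'[OF geo[of "\<bar>f t\<bar>"], of 0])
          (auto simp: abs_mult indicator_def)
    qed
    show "summable (\<lambda>k. \<integral>t. norm (?u k t) \<partial>N)"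
    proof (rule summable_comparison_test'[OF geo[of "\<integral>t. \<bar>f t\<bar> \<partial>N"], of 0])
      fix k
      have "(\<integral>t. norm (?u k t) \<partial>N) \<le> (\<integral>t. (1/2)^Suc k * \<bar>f t\<bar> \<partial>N)"
        using f int by (intro integral_mono integrable_norm integrable_mult_right integrable_abs)
          (auto simp: abs_mult indicator_def)
      then show "norm (\<integral>t. norm (?u k t) \<partial>N) \<le> (1/2)^Suc k * (\<integral>t. \<bar>f t\<bar> \<partial>N)"
        by simp
    qed
  qed
  have "(\<integral>t. (\<Sum>k. ?u k t) \<partial>N) = (\<integral>t. h t * f t \<partial>N)"
  proof (rule Bochner_Integration.integral_cong[OF refl])
    fix t assume "t \<in> space N"
    from sums_mult2[OF h[OF this], of "f t"] show "(\<Sum>k. ?u k t) = h t * f t"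
      by (simp add: sums_iff mult.assoc)
  qed
  with * show ?thesis
    using int by simp
qed

\<comment> \<open>Gives convergence of absolutely summable series of vectors, as needed for the
  dyadic series.\<close>
subclass (in complex_hilbert_space) banach ..

section \<open>Spectral measures and their scalar measures\<close>

locale projection_valued =
  fixes M :: "'b measure" and E :: "'b set \<Rightarrow> 'a::complex_hilbert_space \<Rightarrow> 'a"
  assumes spectral_measure_E: "spectral_measure M E"
begin

abbreviation \<nu> :: "'a \<Rightarrow> 'b measure" where
  "\<nu> x \<equiv> scalar_measure M E x"

lemma povm_E: "povm M E" and E_space [simp]: "E (space M) x = x"
  using spectral_measure_E by (auto simp: spectral_measure_def normalized_povm_def)

lemma E_bounded_clinear: "B \<in> sets M \<Longrightarrow> bounded_clinear (E B)"
  and E_adjoint: "B \<in> sets M \<Longrightarrow> cinner (E B x) y = cinner x (E B y)"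
  using povm_E by (auto simp: povm_def positive_operator_def adjoint_pair_def)

lemma E_idem: "B \<in> sets M \<Longrightarrow> E B (E B x) = E B x"
  using spectral_measure_E by (auto simp: spectral_measure_def)

lemmas E_linear = bounded_clinearD[OF E_bounded_clinear]

lemma E_form: "B \<in> sets M \<Longrightarrow> cinner (E B x) x = of_real ((norm (E B x))\<^sup>2)"
  by (metis E_adjoint E_idem cinner_self)

lemma emeasure_nu: "B \<in> sets M \<Longrightarrow> emeasure (\<nu> x) B = ennreal ((norm (E B x))\<^sup>2)"
  by (simp add: emeasure_scalar_measure[OF povm_E] E_form)

lemma measure_nu: "B \<in> sets M \<Longrightarrow> measure (\<nu> x) B = (norm (E B x))\<^sup>2"
  by (simp add: measure_def emeasure_nu)

lemma finite_measure_nu: "finite_measure (\<nu> x)"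
  by (rule finite_measureI) (simp add: emeasure_nu)

lemma integrable_nu:
  assumes "f \<in> borel_measurable M" "\<And>t. t \<in> space M \<Longrightarrow> \<bar>f t\<bar> \<le> (c::real)"
  shows "integrable (\<nu> x) f"
  using assms by (intro finite_measure.integrable_const_bound[OF finite_measure_nu, where B = c])
    (auto cong: measurable_cong_sets)

lemma norm_E_le: "B \<in> sets M \<Longrightarrow> norm (E B x) \<le> norm x"
proof -
  assume B: "B \<in> sets M"
  have "measure (\<nu> x) B \<le> measure (\<nu> x) (space (\<nu> x))"
    by (rule finite_measure.bounded_measure[OF finite_measure_nu])
  then show ?thesis
    using B by (simp add: measure_nu power2_le_iff_abs_le)
qed

lemma E_empty [simp]: "E {} x = 0"
  using measure_nu[of "{}" x] by simp

text \<open>Additivity holds for the measures \<open>\<nu> x\<close>, that is, for the quadratic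
  forms; polarization lifts it to the operators.\<close>

lemma E_Un:
  assumes B: "B \<in> sets M" and C: "C \<in> sets M" and disj: "B \<inter> C = {}"
  shows "E (B \<union> C) x = E B x + E C x"
proof (rule polarization_eq[of "E (B \<union> C)" "\<lambda>x. E B x + E C x"])
  have BC: "B \<union> C \<in> sets M" using B C by auto
  note E_linear[OF B, simp] E_linear[OF C, simp] E_linear[OF BC, simp]
  show "cinner (E (B \<union> C) x) x = cinner (E B x + E C x) x" for x
  proof -
    have "measure (\<nu> x) (B \<union> C) = measure (\<nu> x) B + measure (\<nu> x) C"
      using B C disj by (intro finite_measure.finite_measure_Union finite_measure_nu) auto
    then show ?thesis
      using B C BC by (simp add: measure_nu cinner_add_left E_form flip: of_real_add of_real_power)
  qed
qed (use E_linear[OF B] E_linear[OF C] E_linear[of "B \<union> C"] B C in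
    \<open>auto simp: scaleC_add_right algebra_simps\<close>)

text \<open>For \<open>y = E B x\<close> idempotence makes the \<open>\<nu> y\<close> mass of
  \<open>B\<close> equal to the total mass, so nothing is left for a set disjoint from
  \<open>B\<close>.\<close>

lemma E_disjoint:
  assumes B: "B \<in> sets M" and C: "C \<in> sets M" and disj: "B \<inter> C = {}"
  shows "E C (E B x) = 0"
proof -
  let ?y = "E B x"
  have "measure (\<nu> ?y) (B \<union> C) = measure (\<nu> ?y) B + measure (\<nu> ?y) C"
    using B C disj by (intro finite_measure.finite_measure_Union finite_measure_nu) auto
  moreover have "measure (\<nu> ?y) (B \<union> C) \<le> measure (\<nu> ?y) (space (\<nu> ?y))"
    by (rule finite_measure.bounded_measure[OF finite_measure_nu])
  ultimately show ?thesis
    using B C by (simp add: measure_nu E_idem)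
qed

text \<open>Split both \<open>B\<close> and \<open>C\<close> along \<open>B \<inter> C\<close>; the
  mixed terms vanish by \<open>E_disjoint\<close>.\<close>

lemma E_Int:
  assumes B: "B \<in> sets M" and C: "C \<in> sets M"
  shows "E B (E C x) = E (B \<inter> C) x"
proof -
  have sets: "B \<inter> C \<in> sets M" "C - B \<in> sets M" "B - C \<in> sets M"
    using B C by auto
  have sets_eq: "B \<inter> C \<union> (C - B) = C" "B \<inter> C \<union> (B - C) = B"
    by auto
  have "E C x = E (B \<inter> C) x + E (C - B) x"
    using E_Un[OF sets(1,2), of x] sets_eq(1) by auto
  moreover have "E B (E (C - B) x) = 0"
    by (rule E_disjoint) (use sets B in auto)
  moreover have "E B (E (B \<inter> C) x) = E (B \<inter> C) (E (B \<inter> C) x) + E (B - C) (E (B \<inter> C) x)"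
    using E_Un[OF sets(1,3), of "E (B \<inter> C) x"] sets_eq(2) by auto
  moreover have "E (B - C) (E (B \<inter> C) x) = 0"
    by (rule E_disjoint) (use sets in auto)
  ultimately show ?thesis
    using sets by (simp add: E_linear[OF B] E_idem)
qed

lemma E_compl: "B \<in> sets M \<Longrightarrow> E (space M - B) x = x - E B x"
  using E_Un[of B "space M - B" x] sets.sets_into_space[of B M]
  by (simp add: Un_absorb1 algebra_simps)

text \<open>The dictionary between almost everywhere statements and fixed vectors of projections:
  the complement is null for \<open>\<nu> x\<close> exactly when its projection kills
  \<open>x\<close>.\<close>

lemma AE_nu_iff:
  assumes "{t \<in> space M. P t} \<in> sets M"
  shows "(AE t in \<nu> x. P t) \<longleftrightarrow> E {t \<in> space M. P t} x = x"
proof -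
  have *: "{t \<in> space M. \<not> P t} = space M - {t \<in> space M. P t}" by auto
  have "(AE t in \<nu> x. P t) \<longleftrightarrow> emeasure (\<nu> x) {t \<in> space M. \<not> P t} = 0"
    using assms unfolding * by (subst AE_iff_measurable[OF _ refl]) (auto simp: *[symmetric])
  also have "\<dots> \<longleftrightarrow> E {t \<in> space M. P t} x = x"
    unfolding * using assms by (auto simp: emeasure_nu E_compl)
  finally show ?thesis .
qed

lemma nu_E:
  assumes "B \<in> sets M"
  shows "\<nu> (E B x) = density (\<nu> x) (indicator B)"
proof (rule measure_eqI)
  fix C assume "C \<in> sets (\<nu> (E B x))"
  then have C: "C \<in> sets M" by simp
  have "emeasure (density (\<nu> x) (indicator B)) C = (\<integral>\<^sup>+t. indicator B t * indicator C t \<partial>\<nu> x)"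
    using assms C by (intro emeasure_density) (auto intro!: borel_measurable_indicator)
  also have "\<dots> = emeasure (\<nu> x) (B \<inter> C)"
    using assms C by (simp add: nn_integral_indicator flip: indicator_inter_arith)
  finally show "emeasure (\<nu> (E B x)) C = emeasure (density (\<nu> x) (indicator B)) C"
    using assms C by (simp add: emeasure_nu E_Int[OF C assms] Int_commute[of B C] sets.Int)
qed simp

lemma integral_nu_E:
  fixes f :: "'b \<Rightarrow> real"
  assumes "B \<in> sets M" "f \<in> borel_measurable M"
  shows "(\<integral>t. f t \<partial>\<nu> (E B x)) = (\<integral>t. indicator B t * f t \<partial>\<nu> x)"
proof -
  have "\<nu> (E B x) = density (\<nu> x) (\<lambda>t. ennreal (indicator B t))"
    unfolding nu_E[OF assms(1)] by (simp add: ennreal_indicator)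
  moreover have "(\<integral>t. f t \<partial>density (\<nu> x) (\<lambda>t. ennreal (indicator B t))) =
      (\<integral>t. indicator B t *\<^sub>R f t \<partial>\<nu> x)"
    using assms by (intro integral_density) (auto cong: measurable_cong_sets)
  ultimately show ?thesis by simp
qed

section \<open>Dyadic series of spectral projections\<close>

lemma dyadic_summable:
  assumes "range B \<subseteq> sets M"
  shows "summable (\<lambda>k. (1/2)^Suc k *\<^sub>R E (B k) x)"
proof (rule summable_comparison_test'[of "\<lambda>k. (1/2::real)^Suc k * norm x" 0])
  show "summable (\<lambda>k. (1/2::real)^Suc k * norm x)"
    by (intro summable_mult2) (simp add: summable_geometric)
  show "norm ((1/2)^Suc k *\<^sub>R E (B k) x) \<le> (1/2)^Suc k * norm x" for k
    using norm_E_le[of "B k" x] assms by (auto simp: range_subsetD)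
qed

text \<open>By multiplicativity of \<open>E\<close> the \<open>k\<close>-th term contributes the
  \<open>\<nu> x\<close> measure of \<open>B k \<inter> C\<close>, weighted by
  \<open>(1/2)^Suc k\<close>. The same weighted measures sum to the integral of \<open>h\<close>
  over \<open>C\<close>.\<close>

lemma dyadic_cinner:
  assumes B: "range B \<subseteq> sets M"
    and h: "\<And>t. t \<in> space M \<Longrightarrow> (\<lambda>k. (1/2)^Suc k * indicator (B k) t) sums h t"
    and C: "C \<in> sets M"
    and v: "(\<lambda>k. (1/2)^Suc k *\<^sub>R E (B k) x) sums v"
  shows "cinner v (E C x) = of_real (\<integral>t. indicator C t * h t \<partial>\<nu> x)"
proof -
  have Bk: "B k \<in> sets M" for k using B by auto
  have "(\<lambda>k. (1/2)^Suc k * (\<integral>t. indicator (B k) t * indicator C t \<partial>\<nu> x)) sums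
      (\<integral>t. h t * indicator C t \<partial>\<nu> x)"
    by (rule dyadic_integral_sums) (use B h C in \<open>auto simp: finite_measure_nu
      intro!: integrable_real_indicator simp: emeasure_nu\<close>)
  moreover have "(\<integral>t. indicator (B k) t * indicator C t \<partial>\<nu> x) = (norm (E (B k \<inter> C) x))\<^sup>2" for k
    using Bk[of k] C by (simp add: measure_nu flip: indicator_inter_arith)
  ultimately have "(\<lambda>k. complex_of_real ((1/2)^Suc k * (norm (E (B k \<inter> C) x))\<^sup>2)) sums
      of_real (\<integral>t. h t * indicator C t \<partial>\<nu> x)"
    by (intro sums_of_real) simp
  moreover have "cinner ((1/2)^Suc k *\<^sub>R E (B k) x) (E C x) =
      complex_of_real ((1/2)^Suc k * (norm (E (B k \<inter> C) x))\<^sup>2)" for k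
  proof -
    have "cinner (E (B k) x) (E C x) = cinner (E (B k \<inter> C) x) x"
      using E_adjoint[OF C, of "E (B k) x" x] E_Int[OF C Bk[of k], of x] by (simp add: Int_commute)
    also have "\<dots> = of_real ((norm (E (B k \<inter> C) x))\<^sup>2)"
      using Bk[of k] C by (intro E_form) auto
    finally show ?thesis
      by (simp only: cinner_scaleR_left of_real_mult)
  qed
  ultimately have "(\<lambda>k. cinner ((1/2)^Suc k *\<^sub>R E (B k) x) (E C x)) sums
      of_real (\<integral>t. h t * indicator C t \<partial>\<nu> x)"
    by (simp only:)
  from sums_unique2[OF bounded_linear.sums[OF bounded_linear_cinner_left v] this]
  show ?thesis by (simp add: mult.commute)
qed

section \<open>Positive contractions as integrals against the spectral measure\<close>

text \<open>\<open>S = \<integral> h dE\<close> for \<open>h\<close> with values in \<open>[0, 1]\<close>.\<close>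

definition represents :: "('b \<Rightarrow> real) \<Rightarrow> ('a \<Rightarrow> 'a) \<Rightarrow> bool" where
  "represents h S \<longleftrightarrow> h \<in> borel_measurable M \<and> (\<forall>t\<in>space M. 0 \<le> h t \<and> h t \<le> 1) \<and>
     bounded_clinear S \<and> (\<forall>x. cinner (S x) x = of_real (\<integral>t. h t \<partial>\<nu> x))"

lemma representsD:
  assumes "represents h S"
  shows "h \<in> borel_measurable M" "\<And>t. t \<in> space M \<Longrightarrow> 0 \<le> h t" "\<And>t. t \<in> space M \<Longrightarrow> h t \<le> 1"
    "bounded_clinear S" "\<And>x. cinner (S x) x = of_real (\<integral>t. h t \<partial>\<nu> x)"
  using assms by (auto simp: represents_def)

text \<open>The limit of the series is linear in \<open>x\<close> and, by
  \<open>dyadic_cinner\<close> on the whole space, has the quadratic form of \<open>S\<close>;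
  polarization does the rest. Any sequence of digit sets is allowed, so they may be chosen in a
  smaller sigma-algebra later.\<close>

lemma represents_sums:
  assumes S: "represents h S"
    and B: "range B \<subseteq> sets M"
    and h: "\<And>t. t \<in> space M \<Longrightarrow> (\<lambda>k. (1/2)^Suc k * indicator (B k) t) sums h t"
  shows "(\<lambda>k. (1/2)^Suc k *\<^sub>R E (B k) x) sums S x"
proof -
  let ?D = "\<lambda>x. \<Sum>k. (1/2)^Suc k *\<^sub>R E (B k) x"
  have Bk: "B k \<in> sets M" for k using B by auto
  have D: "(\<lambda>k. (1/2)^Suc k *\<^sub>R E (B k) x) sums ?D x" for x
    by (rule summable_sums[OF dyadic_summable[OF B]])
  have "?D x = S x"
  proof (rule polarization_eq[of ?D S])
    show "?D (x + y) = ?D x + ?D y" for x y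
      using sums_add[OF D[of x] D[of y]]
      by (intro sums_unique[symmetric]) (simp add: E_linear[OF Bk] scaleR_add_right)
    show "?D (c *\<^sub>C x) = c *\<^sub>C ?D x" for c x
      using bounded_linear.sums[OF bounded_linear_scaleC_right D[of x]]
      by (intro sums_unique[symmetric]) (simp add: E_linear[OF Bk] scaleC_scaleR)
    show "cinner (?D x) x = cinner (S x) x" for x
    proof -
      have "cinner (?D x) x = of_real (\<integral>t. indicator (space M) t * h t \<partial>\<nu> x)"
        using dyadic_cinner[OF B h sets.top D, of x] by simp
      also have "(\<integral>t. indicator (space M) t * h t \<partial>\<nu> x) = (\<integral>t. h t \<partial>\<nu> x)"
        by (rule Bochner_Integration.integral_cong) auto
      finally show ?thesis
        using representsD(5)[OF S] by simp
    qed
  qed (use bounded_clinearD[OF representsD(4)[OF S]] in auto)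
  with D[of x] show ?thesis by (simp only:)
qed

lemma represents_digits:
  assumes "represents h S"
  obtains B where "range B \<subseteq> sets M"
    "\<And>t. t \<in> space M \<Longrightarrow> (\<lambda>k. (1/2)^Suc k * indicator (B k) t) sums h t"
    "\<And>x. (\<lambda>k. (1/2)^Suc k *\<^sub>R E (B k) x) sums S x"
proof -
  obtain B where "range B \<subseteq> sets M"
    "\<And>t. t \<in> space M \<Longrightarrow> (\<lambda>k. (1/2)^Suc k * indicator (B k) t) sums h t"
    using binary_digit_sets[of h M] assms by (auto simp: represents_def)
  with represents_sums[OF assms this] that show ?thesis by blast
qed

lemma represents_cinner:
  assumes "represents h S" "C \<in> sets M"
  shows "cinner (S x) (E C x) = of_real (\<integral>t. indicator C t * h t \<partial>\<nu> x)"
proof -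
  obtain B where B: "range B \<subseteq> sets M"
    "\<And>t. t \<in> space M \<Longrightarrow> (\<lambda>k. (1/2)^Suc k * indicator (B k) t) sums h t"
    "\<And>x. (\<lambda>k. (1/2)^Suc k *\<^sub>R E (B k) x) sums S x"
    by (rule represents_digits[OF assms(1)]) blast
  from dyadic_cinner[OF B(1,2) assms(2) B(3)] show ?thesis .
qed

text \<open>Each term of the dyadic series commutes with \<open>E C\<close> by \<open>E_Int\<close>,
  and \<open>E C\<close> is continuous.\<close>

lemma represents_commute:
  assumes "represents h S" "C \<in> sets M"
  shows "S (E C x) = E C (S x)"
proof -
  obtain B where B: "range B \<subseteq> sets M"
    "\<And>x. (\<lambda>k. (1/2)^Suc k *\<^sub>R E (B k) x) sums S x"
    by (rule represents_digits[OF assms(1)]) blast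
  have Bk: "B k \<in> sets M" for k using B by auto
  have "(\<lambda>k. E C ((1/2)^Suc k *\<^sub>R E (B k) x)) sums E C (S x)"
    by (rule bounded_linear.sums[OF E_linear(1)[OF assms(2)] B(2)])
  then have "(\<lambda>k. (1/2)^Suc k *\<^sub>R E (B k) (E C x)) sums E C (S x)"
    by (simp add: E_linear[OF assms(2)] E_Int[OF Bk assms(2)] E_Int[OF assms(2) Bk] Int_commute)
  from sums_unique2[OF B(2) this] show ?thesis .
qed

text \<open>Expanding only the second argument of \<open>cinner (S x) (S x)\<close> into the dyadic
  series produces the terms computed in \<open>represents_cinner\<close>.\<close>

lemma represents_norm:
  assumes S: "represents h S"
  shows "(norm (S x))\<^sup>2 = (\<integral>t. (h t)\<^sup>2 \<partial>\<nu> x)"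
proof -
  note h = representsD[OF S]
  obtain B where B: "range B \<subseteq> sets M"
    "\<And>t. t \<in> space M \<Longrightarrow> (\<lambda>k. (1/2)^Suc k * indicator (B k) t) sums h t"
    "\<And>x. (\<lambda>k. (1/2)^Suc k *\<^sub>R E (B k) x) sums S x"
    by (rule represents_digits[OF S]) blast
  have Bk: "B k \<in> sets M" for k using B by auto
  have "integrable (\<nu> x) h"
    using h by (intro integrable_nu[of _ 1]) (auto simp: abs_le_iff intro: order_trans[of _ 0])
  then have "(\<lambda>k. (1/2)^Suc k * (\<integral>t. indicator (B k) t * h t \<partial>\<nu> x)) sums (\<integral>t. h t * h t \<partial>\<nu> x)"
    by (intro dyadic_integral_sums) (use B in \<open>auto simp: finite_measure_nu\<close>)
  then have "(\<lambda>k. complex_of_real ((1/2)^Suc k * (\<integral>t. indicator (B k) t * h t \<partial>\<nu> x))) sums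
      of_real (\<integral>t. h t * h t \<partial>\<nu> x)"
    by (rule sums_of_real)
  moreover have "(\<lambda>k. cinner (S x) ((1/2)^Suc k *\<^sub>R E (B k) x)) sums cinner (S x) (S x)"
    by (rule bounded_linear.sums[OF bounded_linear_cinner_right B(3)])
  ultimately have "cinner (S x) (S x) = of_real (\<integral>t. h t * h t \<partial>\<nu> x)"
    by (intro sums_unique2[of "\<lambda>k. cinner (S x) ((1/2)^Suc k *\<^sub>R E (B k) x)"])
      (simp_all only: cinner_scaleR_right represents_cinner[OF S Bk] of_real_mult)
  then show ?thesis
    unfolding cinner_self by (simp only: of_real_eq_iff power2_eq_square)
qed

text \<open>As \<open>S\<close> commutes with \<open>E C\<close>, the norm formula applied to
  \<open>E C x\<close> gives the mass of \<open>C\<close>.\<close>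

lemma nu_represents:
  assumes S: "represents h S"
  shows "\<nu> (S x) = density (\<nu> x) (\<lambda>t. ennreal ((h t)\<^sup>2))"
proof (rule measure_eqI)
  fix C assume "C \<in> sets (\<nu> (S x))"
  then have C: "C \<in> sets M" by simp
  have [measurable]: "h \<in> borel_measurable M" "C \<in> sets M"
    using representsD(1)[OF S] C by auto
  have "(norm (E C (S x)))\<^sup>2 = (\<integral>t. (h t)\<^sup>2 \<partial>\<nu> (E C x))"
    by (simp add: represents_norm[OF S] flip: represents_commute[OF S C])
  also have "\<dots> = (\<integral>t. indicator C t * (h t)\<^sup>2 \<partial>\<nu> x)"
    using C by (intro integral_nu_E) auto
  finally have "emeasure (\<nu> (S x)) C = ennreal (\<integral>t. indicator C t * (h t)\<^sup>2 \<partial>\<nu> x)"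
    by (simp add: emeasure_nu C)
  also have "\<dots> = (\<integral>\<^sup>+t. ennreal (indicator C t * (h t)\<^sup>2) \<partial>\<nu> x)"
  proof (rule nn_integral_eq_integral[symmetric])
    show "integrable (\<nu> x) (\<lambda>t. indicator C t * (h t)\<^sup>2)"
      using representsD(2,3)[OF S]
      by (intro integrable_nu[of _ 1]) (auto simp: indicator_def power_le_one)
  qed auto
  also have "\<dots> = (\<integral>\<^sup>+t. ennreal ((h t)\<^sup>2) * indicator C t \<partial>\<nu> x)"
    by (intro nn_integral_cong) (auto simp: indicator_def)
  also have "\<dots> = emeasure (density (\<nu> x) (\<lambda>t. ennreal ((h t)\<^sup>2))) C"
    by (rule emeasure_density[symmetric]) (auto cong: measurable_cong_sets)
  finally show "emeasure (\<nu> (S x)) C = emeasure (density (\<nu> x) (\<lambda>t. ennreal ((h t)\<^sup>2))) C" .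
qed simp

end

section \<open>Spectral projections recovered from the growth of powers of an operator\<close>

section \<open>Uniqueness of the spectral measure\<close>

context projection_valued
begin

lemma nu_represents_power:
  assumes S: "represents h S"
  shows "\<nu> ((S ^^ n) x) = density (\<nu> x) (\<lambda>t. ennreal ((h t) ^ (2 * n)))"
proof (induction n)
  case 0
  then show ?case by (simp add: density_1)
next
  case (Suc n)
  have [measurable]: "h \<in> borel_measurable (\<nu> x)"
    using representsD(1)[OF S] by (auto cong: measurable_cong_sets)
  have "\<nu> ((S ^^ Suc n) x) = density (density (\<nu> x) (\<lambda>t. ennreal ((h t) ^ (2 * n)))) (\<lambda>t. ennreal ((h t)\<^sup>2))"
    by (simp add: nu_represents[OF S] Suc)
  also have "\<dots> = density (\<nu> x) (\<lambda>t. ennreal ((h t) ^ (2 * n)) * ennreal ((h t)\<^sup>2))"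
    by (rule density_density_eq) auto
  also have "\<dots> = density (\<nu> x) (\<lambda>t. ennreal ((h t) ^ (2 * Suc n)))"
    by (simp add: power_add[symmetric] flip: ennreal_mult'')
  finally show ?case .
qed

lemma norm_represents_power:
  assumes S: "represents h S"
  shows "ennreal ((norm ((S ^^ n) x))\<^sup>2) = (\<integral>\<^sup>+t. ennreal ((h t) ^ (2 * n)) \<partial>\<nu> x)"
proof -
  have [measurable]: "h \<in> borel_measurable (\<nu> x)"
    using representsD(1)[OF S] by (auto cong: measurable_cong_sets)
  have "ennreal ((norm ((S ^^ n) x))\<^sup>2) = emeasure (\<nu> ((S ^^ n) x)) (space M)"
    by (simp add: emeasure_nu)
  also have "\<dots> = (\<integral>\<^sup>+t. ennreal ((h t) ^ (2 * n)) * indicator (space M) t \<partial>\<nu> x)"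
    unfolding nu_represents_power[OF S] by (rule emeasure_density) auto
  also have "\<dots> = (\<integral>\<^sup>+t. ennreal ((h t) ^ (2 * n)) \<partial>\<nu> x)"
    by (rule nn_integral_cong) auto
  finally show ?thesis .
qed

text \<open>
  The right-hand side mentions only \<open>S\<close>, so the spectral subspaces do not depend on \<open>E\<close>.
\<close>

lemma spectral_subspace_iff:
  assumes S: "represents h S" and c: "0 \<le> c"
  shows "E {t \<in> space M. h t \<le> c} x = x \<longleftrightarrow> (\<forall>n. norm ((S ^^ n) x) \<le> c ^ n * norm x)"
proof
  have [measurable]: "h \<in> borel_measurable M"
    using representsD(1)[OF S] .
  have pow: "ennreal ((c ^ n * norm x)\<^sup>2) = (\<integral>\<^sup>+t. ennreal (c ^ (2 * n)) \<partial>\<nu> x)" for n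
    using c by (simp add: emeasure_nu power_mult_distrib power_mult[symmetric] mult.commute
        flip: ennreal_mult'')
  {
    assume "E {t \<in> space M. h t \<le> c} x = x"
    then have AE: "AE t in \<nu> x. h t \<le> c"
      by (subst AE_nu_iff) auto
    show "\<forall>n. norm ((S ^^ n) x) \<le> c ^ n * norm x"
    proof
      fix n
      have "ennreal ((norm ((S ^^ n) x))\<^sup>2) \<le> ennreal ((c ^ n * norm x)\<^sup>2)"
        unfolding norm_represents_power[OF S] pow
      proof (rule nn_integral_mono_AE)
        show "AE t in \<nu> x. ennreal ((h t) ^ (2 * n)) \<le> ennreal (c ^ (2 * n))"
          using AE AE_space
          by eventually_elim (use representsD(2)[OF S] in \<open>auto intro!: ennreal_leI power_mono\<close>)
      qed
      then show "norm ((S ^^ n) x) \<le> c ^ n * norm x"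
        using c by (simp add: power_mono_iff)
    qed
  }
  {
    assume *: "\<forall>n. norm ((S ^^ n) x) \<le> c ^ n * norm x"
    \<comment> \<open>Chebyshev's inequality for all powers at once: where \<open>h\<close> is at
      least \<open>d > c\<close>, the power \<open>h ^ (2 * n)\<close> is at least
      \<open>d ^ (2 * n)\<close>, while its integral is at most
      \<open>c ^ (2 * n) * (norm x)\<^sup>2\<close>. Letting \<open>n\<close> grow forces this set
      to be null.\<close>
    have "AE t in \<nu> x. h t < d" if d: "c < d" for d
    proof -
      define B where "B = {t \<in> space M. d \<le> h t}"
      have B: "B \<in> sets M" unfolding B_def by measurable
      have "d ^ (2 * n) * (norm (E B x))\<^sup>2 \<le> c ^ (2 * n) * (norm x)\<^sup>2" for n
      proof -
        have "ennreal (d ^ (2 * n) * (norm (E B x))\<^sup>2) = (\<integral>\<^sup>+t. ennreal (d ^ (2 * n)) * indicator B t \<partial>\<nu> x)"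
          using B c d by (simp add: nn_integral_cmult_indicator emeasure_nu ennreal_mult'')
        also have "\<dots> \<le> (\<integral>\<^sup>+t. ennreal ((h t) ^ (2 * n)) \<partial>\<nu> x)"
          using c d by (intro nn_integral_mono) (auto simp: B_def indicator_def intro!: ennreal_leI power_mono)
        also have "\<dots> = ennreal ((norm ((S ^^ n) x))\<^sup>2)"
          by (rule norm_represents_power[OF S, symmetric])
        also have "\<dots> \<le> ennreal ((c ^ n * norm x)\<^sup>2)"
          using * by (intro ennreal_leI power_mono) auto
        finally show ?thesis
          using c by (simp add: power_mult_distrib power_mult[symmetric] mult.commute)
      qed
      then have le: "(norm (E B x))\<^sup>2 \<le> ((c / d)\<^sup>2) ^ n * (norm x)\<^sup>2" for n
        using c d by (simp add: power_divide power_mult[symmetric] field_simps)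
      have "(c / d)\<^sup>2 < 1"
        using c d by (simp add: power_less_one_iff abs_square_less_1)
      then have "(\<lambda>n. ((c / d)\<^sup>2) ^ n * (norm x)\<^sup>2) \<longlonglongrightarrow> 0 * (norm x)\<^sup>2"
        by (intro tendsto_intros LIMSEQ_realpow_zero) auto
      then have "(norm (E B x))\<^sup>2 \<le> 0"
        using le by (intro LIMSEQ_le_const[of _ "0 * (norm x)\<^sup>2", simplified]) auto
      then have "E B x = 0"
        by simp
      moreover have "{t \<in> space M. h t < d} = space M - B"
        by (auto simp: B_def)
      ultimately show ?thesis
        using B by (subst AE_nu_iff) (auto simp: E_compl)
    qed
    \<comment> \<open>Countably many levels \<open>d\<close> approaching \<open>c\<close> suffice,
      so the exceptional null sets can be united.\<close>
    then have "AE t in \<nu> x. \<forall>k. h t < c + 1 / real (Suc k)"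
      by (subst AE_all_countable) simp
    then have "AE t in \<nu> x. h t \<le> c"
    proof eventually_elim
      case (elim t)
      show ?case
      proof (rule ccontr)
        assume "\<not> h t \<le> c"
        then obtain k where "1 / real (Suc k) < h t - c"
          using reals_Archimedean[of "h t - c"] by (auto simp: inverse_eq_divide)
        with elim[rule_format, of k] show False by simp
      qed
    qed
    then show "E {t \<in> space M. h t \<le> c} x = x"
      by (subst (asm) AE_nu_iff) auto
  }
qed

lemma integrable_const_nu: "integrable (\<nu> x) (\<lambda>_. c::real)"
  by (rule finite_measure.integrable_const[OF finite_measure_nu])

text \<open>If \<open>D\<close> carries the vector, then \<open>E B x = E B (E D x)\<close> sees
  only the trace of \<open>B\<close> on \<open>D\<close>.\<close>

lemma E_cong_on:
  assumes "B \<in> sets M" "C \<in> sets M" "D \<in> sets M" "B \<inter> D = C \<inter> D" "E D x = x"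
  shows "E B x = E C x"
  by (metis E_Int assms)

end

text \<open>With equal ranges, each projection fixes the range of the other, so
  \<open>Q P = P\<close> and \<open>P Q = Q\<close>; passing to the adjoint in the first identity
  yields \<open>P = Q\<close>.\<close>

lemma projections_eqI:
  fixes P Q :: "'a::complex_hilbert_space \<Rightarrow> 'a"
  assumes adj: "\<And>x y. cinner (P x) y = cinner x (P y)" "\<And>x y. cinner (Q x) y = cinner x (Q y)"
    and idem: "\<And>x. P (P x) = P x" "\<And>x. Q (Q x) = Q x"
    and range: "\<And>x. P x = x \<longleftrightarrow> Q x = x"
  shows "P x = Q x"
proof (rule cinner_left_eqI)
  fix y
  have "cinner (P x) y = cinner (Q (P x)) y"
    using range idem by simp
  also have "\<dots> = cinner x (P (Q y))"
    by (simp add: adj)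
  also have "\<dots> = cinner (Q x) y"
    using range[of "Q y"] idem by (simp add: adj)
  finally show "cinner (P x) y = cinner (Q x) y" .
qed

text \<open>The subspaces for \<open>h \<le> c\<close> depend on \<open>S\<close> alone, so the
  images under \<open>h\<close> of the two scalar measures have the same distribution function and
  coincide. Polarization then gives equality of the projections.\<close>

lemma spectral_projection_unique:
  assumes E: "projection_valued M E" "projection_valued.represents M E h S"
    and E': "projection_valued M E'" "projection_valued.represents M E' h S"
    and B: "B \<in> sets borel"
  shows "E (h -` B \<inter> space M) x = E' (h -` B \<inter> space M) x"
proof -
  interpret E: projection_valued M E by fact
  interpret E': projection_valued M E' by fact
  have h [measurable]: "h \<in> borel_measurable M"
    by (rule E.representsD(1)[OF E(2)])
  have le: "E {t \<in> space M. h t \<le> c} y = E' {t \<in> space M. h t \<le> c} y" for c y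
  proof (cases "0 \<le> c")
    case True
    have sets: "{t \<in> space M. h t \<le> c} \<in> sets M" by measurable
    show ?thesis
      by (rule projections_eqI)
        (simp_all only: E.E_adjoint[OF sets] E'.E_adjoint[OF sets] E.E_idem[OF sets] E'.E_idem[OF sets]
          E.spectral_subspace_iff[OF E(2) True] E'.spectral_subspace_iff[OF E'(2) True])
  next
    case False
    then have "{t \<in> space M. h t \<le> c} = {}"
      using E.representsD(2)[OF E(2)] by force
    then show ?thesis by (simp only: E.E_empty E'.E_empty)
  qed
  have "distr (E.\<nu> y) borel h = distr (E'.\<nu> y) borel h" for y
  proof (rule cdf_unique')
    have "finite_measure (distr (E.\<nu> y) borel h)" "finite_measure (distr (E'.\<nu> y) borel h)"
      by (auto intro!: finite_measure.finite_measure_distr E.finite_measure_nu E'.finite_measure_nu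
          cong: measurable_cong_sets)
    then show "finite_borel_measure (distr (E.\<nu> y) borel h)"
      "finite_borel_measure (distr (E'.\<nu> y) borel h)"
      by (auto simp: finite_borel_measure_def finite_borel_measure_axioms_def)
    have sets: "{t \<in> space M. h t \<le> c} \<in> sets M" for c by measurable
    have "h -` {..c} \<inter> space M = {t \<in> space M. h t \<le> c}" for c
      by auto
    then show "cdf (distr (E.\<nu> y) borel h) = cdf (distr (E'.\<nu> y) borel h)"
      by (auto simp: cdf_def fun_eq_iff measure_distr E.measure_nu[OF sets] E'.measure_nu[OF sets] le
          cong: measurable_cong_sets)
  qed
  then have "measure (distr (E.\<nu> y) borel h) B = measure (distr (E'.\<nu> y) borel h) B" for y
    by simp
  moreover have sets: "h -` B \<inter> space M \<in> sets M"
    using B by (rule measurable_sets[OF h])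
  ultimately have norm: "(norm (E (h -` B \<inter> space M) y))\<^sup>2 = (norm (E' (h -` B \<inter> space M) y))\<^sup>2" for y
    using B by (simp add: measure_distr E.measure_nu[OF sets] E'.measure_nu[OF sets]
        cong: measurable_cong_sets)
  show ?thesis
    by (rule polarization_eq)
      (simp_all only: E.E_linear[OF sets] E'.E_linear[OF sets] E.E_form[OF sets] E'.E_form[OF sets] norm)
qed

text \<open>On the range of the projection for \<open>t > K\<close> or \<open>t < -K\<close>, a
  nonzero vector would have a form exceeding what Cauchy-Schwarz and \<open>K\<close> permit. The
  argument uses the spectral integral and not the resolvent.\<close>

lemma spectral_measure_of_bounded:
  assumes E: "spectral_measure_of (\<lambda>x. Some (T x)) E"
    and K: "\<And>x. norm (T x) \<le> K * norm x"
  shows "E {t \<in> real_spectrum (\<lambda>x. Some (T x)). \<bar>t\<bar> \<le> K} x = x"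
    and "integrable (scalar_measure (spectrum_space (\<lambda>x. Some (T x))) E x) (\<lambda>t. t)"
    and "cinner (T x) x = of_real (\<integral>t. t \<partial>scalar_measure (spectrum_space (\<lambda>x. Some (T x))) E x)"
proof -
  let ?M = "spectrum_space (\<lambda>x. Some (T x))"
  interpret projection_valued ?M E
    using E by unfold_locales (simp add: spectral_measure_of_def)
  have [measurable]: "(\<lambda>t. t) \<in> borel_measurable ?M"
    by (intro measurable_restrict_space1) simp
  have sq: "integrable (\<nu> y) (\<lambda>t. t\<^sup>2)" for y
    using E by (auto simp: spectral_measure_of_def is_spectral_integral_def dom_def)
  have form: "cinner (T y) y = of_real (\<integral>t. t \<partial>\<nu> y)" for y
    using E by (simp add: spectral_measure_of_def is_spectral_integral_def)
  then show "cinner (T x) x = of_real (\<integral>t. t \<partial>\<nu> x)" .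
  have int: "integrable (\<nu> y) (\<lambda>t. t)" for y
  proof (rule Bochner_Integration.integrable_bound)
    \<comment> \<open>On a finite measure space \<open>\<bar>t\<bar> \<le> 1 + t\<^sup>2\<close>
      turns the square integrability from the domain condition into integrability.\<close>
    show "integrable (\<nu> y) (\<lambda>t. 1 + t\<^sup>2)"
      by (intro Bochner_Integration.integrable_add sq
          integrable_const_nu)
    show "AE t in \<nu> y. norm t \<le> norm (1 + t\<^sup>2)"
    proof (rule AE_I2)
      fix t :: real
      have "0 \<le> (1 - \<bar>t\<bar>)\<^sup>2" by simp
      then show "norm t \<le> norm (1 + t\<^sup>2)"
        by (simp add: power2_eq_square algebra_simps)
    qed
  qed (auto cong: measurable_cong_sets)
  then show "integrable (\<nu> x) (\<lambda>t. t)" .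
  \<comment> \<open>The sign \<open>s\<close> treats the upper and the lower tail together.\<close>
  have tail: "E {t \<in> space ?M. K < s * t} x = 0" if s: "s = 1 \<or> s = -1" for s
  proof -
    define B where "B = {t \<in> space ?M. K < s * t}"
    have B: "B \<in> sets ?M" unfolding B_def by measurable
    define y where "y = E B x"
    have AE: "AE t in \<nu> y. K < s * t"
      using B by (subst AE_nu_iff) (auto simp: y_def B_def[symmetric] E_idem)
    have "s * (\<integral>t. t \<partial>\<nu> y) = Re (of_real s * cinner (T y) y)"
      by (simp add: form)
    also have "\<dots> = s * inner (T y) y"
      by (simp add: Re_cinner)
    also have "\<dots> \<le> norm (T y) * norm y"
      using s Cauchy_Schwarz_ineq2[of "T y" y] by auto
    also have "\<dots> \<le> K * norm y * norm y"
      using K by (intro mult_right_mono) auto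
    finally have "(\<integral>t. s * t - K \<partial>\<nu> y) \<le> 0"
      using Bochner_Integration.integral_diff[OF integrable_mult_right[OF int, where c = s]
          integrable_const_nu[of _ K]]
      by (simp add: measure_nu power2_eq_square mult_ac)
    moreover have nonneg: "AE t in \<nu> y. 0 \<le> s * t - K"
      using AE by eventually_elim simp
    then have "0 \<le> (\<integral>t. s * t - K \<partial>\<nu> y)"
      by (rule integral_nonneg_AE)
    ultimately have "(\<integral>t. s * t - K \<partial>\<nu> y) = 0"
      by simp
    then have "AE t in \<nu> y. s * t - K = 0"
      using integral_nonneg_eq_0_iff_AE[OF Bochner_Integration.integrable_diff[OF
            integrable_mult_right[OF int, where c = s] integrable_const_nu[of _ K]] nonneg]
      by simp
    with AE have "AE t in \<nu> y. False"
      by eventually_elim simp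
    then have "E {} y = y"
      by (subst (asm) AE_nu_iff) auto
    then show ?thesis
      by (simp add: y_def B_def)
  qed
  define P N where "P = {t \<in> space ?M. K < t}" and "N = {t \<in> space ?M. K < - t}"
  have PN: "P \<in> sets ?M" "N \<in> sets ?M"
    unfolding P_def N_def by measurable
  have "{t \<in> real_spectrum (\<lambda>x. Some (T x)). \<bar>t\<bar> \<le> K} = (space ?M - P) \<inter> (space ?M - N)"
    by (auto simp: P_def N_def space_restrict_space)
  moreover have "E ((space ?M - P) \<inter> (space ?M - N)) x = x"
    using tail[of 1] tail[of "-1"] PN
    by (simp flip: E_Int add: E_compl E_linear P_def[symmetric] N_def[symmetric])
  ultimately show "E {t \<in> real_spectrum (\<lambda>x. Some (T x)). \<bar>t\<bar> \<le> K} x = x"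
    by simp
qed

section \<open>Rescaling to the unit interval, and uniqueness for bounded operators\<close>

text \<open>The affine map takes \<open>[-K, K]\<close>, which contains the spectrum for \<open>K \<ge> \<parallel>T\<parallel>\<close>, to \<open>[0, 1]\<close>.\<close>

definition rescaled :: "real \<Rightarrow> ('a::complex_hilbert_space \<Rightarrow> 'a) \<Rightarrow> 'a \<Rightarrow> 'a" where
  "rescaled K T x = (1 / (2 * K)) *\<^sub>R (T x + K *\<^sub>R x)"

text \<open>Needed because \<open>represents\<close> demands its bounds at every point, whereas the
  affine image of the spectral variable and, later, a conditional expectation are bounded only
  almost everywhere a priori.\<close>

definition clip :: "real \<Rightarrow> real" where
  "clip t = max 0 (min 1 t)"

lemma clip_measurable [measurable]: "clip \<in> borel_measurable borel"
  unfolding clip_def[abs_def] by measurable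

lemma clip_range [simp]: "0 \<le> clip t" "clip t \<le> 1"
  and clip_id: "0 \<le> t \<Longrightarrow> t \<le> 1 \<Longrightarrow> clip t = t"
  by (auto simp: clip_def)

text \<open>The scalar measures are carried by \<open>[-K, K]\<close>, where clipping changes
  nothing, so the form is the integral of the affine function itself.\<close>

lemma rescaled_represents:
  assumes T: "bounded_clinear T"
    and E: "spectral_measure_of (\<lambda>x. Some (T x)) E"
    and K: "\<And>x. norm (T x) \<le> K * norm x" "0 < K"
  shows "projection_valued.represents (spectrum_space (\<lambda>x. Some (T x))) E
    (\<lambda>t. clip ((t + K) / (2 * K))) (rescaled K T)"
proof -
  let ?M = "spectrum_space (\<lambda>x. Some (T x))"
  interpret projection_valued ?M E
    using E by unfold_locales (simp add: spectral_measure_of_def)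
  have id [measurable]: "(\<lambda>t. t) \<in> borel_measurable ?M"
    by (intro measurable_restrict_space1) simp
  have meas: "(\<lambda>t. clip ((t + K) / (2 * K))) \<in> borel_measurable ?M"
    by measurable
  have "bounded_clinear (rescaled K T)"
    unfolding bounded_clinear_def rescaled_def
    by (auto intro!: bounded_linear_const_scaleR bounded_linear_add bounded_clinearD(1)[OF T]
        bounded_linear_scaleR_right bounded_linear_ident
        simp: bounded_clinearD(4)[OF T] scaleC_add_right scaleC_scaleR)
  moreover have "cinner (rescaled K T x) x = of_real (\<integral>t. clip ((t + K) / (2 * K)) \<partial>\<nu> x)" for x
  proof -
    note b = spectral_measure_of_bounded[OF E K(1), of x]
    have set: "{t \<in> real_spectrum (\<lambda>x. Some (T x)). \<bar>t\<bar> \<le> K} = {t \<in> space ?M. \<bar>t\<bar> \<le> K}"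
      by (simp add: space_restrict_space)
    have AE: "AE t in \<nu> x. \<bar>t\<bar> \<le> K"
      using b(1) unfolding set by (subst AE_nu_iff) auto
    have "(\<integral>t. clip ((t + K) / (2 * K)) \<partial>\<nu> x) = (\<integral>t. (1 / (2 * K)) * (t + K) \<partial>\<nu> x)"
    proof (rule integral_cong_AE)
      show "AE t in \<nu> x. clip ((t + K) / (2 * K)) = (1 / (2 * K)) * (t + K)"
        using AE by eventually_elim (use K(2) in \<open>auto simp: clip_id field_simps abs_le_iff\<close>)
    qed (auto intro: meas cong: measurable_cong_sets)
    also have "\<dots> = (1 / (2 * K)) * ((\<integral>t. t \<partial>\<nu> x) + K * (norm x)\<^sup>2)"
      using Bochner_Integration.integral_add[OF b(2)
          integrable_const_nu[of _ K]]
      by (simp add: measure_nu)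
    finally show ?thesis
      using b(3) by (simp add: rescaled_def cinner_scaleR_left cinner_add_left cinner_self)
  qed
  ultimately show ?thesis
    unfolding represents_def using meas by simp
qed

text \<open>Since \<open>h\<close> is injective on \<open>[-K, K]\<close>, every Borel subset of the
  spectrum agrees there with a preimage under \<open>h\<close>. Both measures are carried by
  \<open>[-K, K]\<close>, so \<open>spectral_projection_unique\<close> suffices.\<close>

lemma spectral_measure_of_unique:
  assumes T: "bounded_clinear T"
    and E: "spectral_measure_of (\<lambda>x. Some (T x)) E"
    and E': "spectral_measure_of (\<lambda>x. Some (T x)) E'"
    and B: "B \<in> sets (spectrum_space (\<lambda>x. Some (T x)))"
  shows "E B x = E' B x"
proof -
  let ?M = "spectrum_space (\<lambda>x. Some (T x))"
  have pv: "projection_valued ?M E" "projection_valued ?M E'"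
    using E E' by (auto simp: projection_valued_def spectral_measure_of_def)
  obtain K where K: "\<And>x. norm (T x) \<le> K * norm x" "0 < K"
    using bounded_linear.pos_bounded[OF bounded_clinearD(1)[OF T]] by (auto simp: mult.commute)
  define h where "h t = clip ((t + K) / (2 * K))" for t
  have rep: "projection_valued.represents ?M E h (rescaled K T)"
    "projection_valued.represents ?M E' h (rescaled K T)"
    unfolding h_def using rescaled_represents[OF T _ K] E E' by auto
  obtain B' where B': "B' \<in> sets borel" "B = real_spectrum (\<lambda>x. Some (T x)) \<inter> B'"
    using B by (auto simp: sets_restrict_space)
  \<comment> \<open>The image of \<open>B'\<close> under
    \<open>t \<mapsto> (t + K) / (2 * K)\<close>, written as a preimage under the inverse map so
    that it is visibly Borel.\<close>
  define C where "C = {s. 2 * K * s - K \<in> B'}"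
  have "C = (\<lambda>s. 2 * K * s - K) -` B' \<inter> space borel"
    by (auto simp: C_def)
  then have C: "C \<in> sets borel"
    using B' by (auto intro!: measurable_sets_borel[of "\<lambda>s. 2 * K * s - K"])
  have hC: "h -` C \<inter> space ?M \<in> sets ?M"
    by (rule measurable_sets[OF _ C]) (use projection_valued.representsD(1)[OF pv(1) rep(1)] in simp)
  let ?D = "{t \<in> real_spectrum (\<lambda>x. Some (T x)). \<bar>t\<bar> \<le> K}"
  have "{t. \<bar>t\<bar> \<le> K} \<in> sets borel"
    by measurable
  moreover have "?D = real_spectrum (\<lambda>x. Some (T x)) \<inter> {t. \<bar>t\<bar> \<le> K}"
    by auto
  ultimately have D: "?D \<in> sets ?M"
    unfolding sets_restrict_space by blast
  have "2 * K * h t - K = t" if "\<bar>t\<bar> \<le> K" for t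
  proof -
    have "h t = (t + K) / (2 * K)"
      unfolding h_def using that K(2) by (intro clip_id) (auto simp: field_simps abs_le_iff)
    then show ?thesis using K(2) by simp
  qed
  then have eq: "B \<inter> ?D = h -` C \<inter> space ?M \<inter> ?D"
    by (auto simp: B'(2) C_def space_restrict_space)
  have "E B x = E (h -` C \<inter> space ?M) x"
    using projection_valued.E_cong_on[OF pv(1) B hC D eq] spectral_measure_of_bounded(1)[OF E K(1)] .
  also have "\<dots> = E' (h -` C \<inter> space ?M) x"
    by (rule spectral_projection_unique[OF pv(1) rep(1) pv(2) rep(2) C])
  also have "\<dots> = E' B x"
    using projection_valued.E_cong_on[OF pv(2) B hC D eq] spectral_measure_of_bounded(1)[OF E' K(1)]
    by metis
  finally show ?thesis .
qed

section \<open>The von Neumann algebra of a sub-sigma-algebra\<close>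

context projection_valued
begin

text \<open>
  The functionals \<open>S \<mapsto> \<Sum>i. \<langle>S x\<^sub>i, y\<^sub>i\<rangle>\<close> are the weakly continuous ones, so this is the weakly closed
  linear span of the projections \<open>E B\<close>; in this form weak closedness is immediate.
\<close>

definition bipolar :: "'b measure \<Rightarrow> ('a \<Rightarrow> 'a) set" where
  "bipolar G = {S. bounded_clinear S \<and>
     (\<forall>n x y. (\<forall>B\<in>sets G. (\<Sum>i<n. cinner (E B (x i)) (y i)) = 0) \<longrightarrow>
        (\<Sum>i<n::nat. cinner (S (x i)) (y i)) = 0)}"

lemma bipolarD:
  fixes n :: nat
  assumes "S \<in> bipolar G" "\<And>B. B \<in> sets G \<Longrightarrow> (\<Sum>i<n. cinner (E B (x i)) (y i)) = 0"
  shows "(\<Sum>i<n. cinner (S (x i)) (y i)) = 0"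
proof -
  have "(\<forall>B\<in>sets G. (\<Sum>i<n. cinner (E B (x i)) (y i)) = 0) \<longrightarrow> (\<Sum>i<n. cinner (S (x i)) (y i)) = 0"
    using assms(1) unfolding bipolar_def by blast
  with assms(2) show ?thesis by blast
qed

lemma bipolar_bounded_clinear: "S \<in> bipolar G \<Longrightarrow> bounded_clinear S"
  by (simp add: bipolar_def)

lemma bipolarI:
  assumes "bounded_clinear S"
    "\<And>n x y. (\<And>B. B \<in> sets G \<Longrightarrow> (\<Sum>i<n::nat. cinner (E B (x i)) (y i)) = 0) \<Longrightarrow>
       (\<Sum>i<n. cinner (S (x i)) (y i)) = 0"
  shows "S \<in> bipolar G"
  unfolding bipolar_def
proof (intro CollectI conjI allI impI)
  fix n and x y :: "nat \<Rightarrow> 'a" assume *: "\<forall>B\<in>sets G. (\<Sum>i<n. cinner (E B (x i)) (y i)) = 0"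
  show "(\<Sum>i<n. cinner (S (x i)) (y i)) = 0"
    by (rule assms(2)) (use * in blast)
qed (rule assms(1))

text \<open>The functional sending \<open>S\<close> to
  \<open>cinner (S (E C u)) w - cinner (S u) (E C w)\<close> annihilates every \<open>E B\<close>,
  hence \<open>S\<close> as well.\<close>

lemma bipolar_commute:
  assumes G: "subalgebra M G" and S: "S \<in> bipolar G" and C: "C \<in> sets G"
  shows "S (E C u) = E C (S u)"
proof (rule cinner_left_eqI)
  fix w
  have CM: "C \<in> sets M" using G C by (auto simp: subalgebra_def)
  \<comment> \<open>The functional with two summands; its minus sign is absorbed into the vector
    \<open>- u\<close>.\<close>
  have "(\<Sum>i<Suc (Suc 0). cinner (S (if i = 0 then E C u else - u)) (if i = 0 then w else E C w)) = 0"
  proof (rule bipolarD[OF S])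
    fix B assume "B \<in> sets G"
    then have BM: "B \<in> sets M" using G by (auto simp: subalgebra_def)
    show "(\<Sum>i<Suc (Suc 0). cinner (E B (if i = 0 then E C u else - u)) (if i = 0 then w else E C w)) = 0"
      by (simp add: E_linear[OF BM] E_linear[OF CM] cinner_minus_left E_adjoint[OF CM, symmetric] E_Int[OF BM CM]
          E_Int[OF CM BM] Int_commute)
  qed
  then show "cinner (S (E C u)) w = cinner (E C (S u)) w"
    by (simp add: bounded_clinearD[OF bipolar_bounded_clinear[OF S]] cinner_minus_left E_adjoint[OF CM])
qed

text \<open>Sums and scalar multiples pass through the functionals, adjoints exchange the two
  families of vectors up to conjugation, and weak closedness holds because each functional is a
  finite sum of matrix coefficients. Only products need the multiplicativity of
  \<open>E\<close>.\<close>

lemma von_neumann_algebra_bipolar: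
  assumes G: "subalgebra M G"
  shows "von_neumann_algebra (bipolar G)"
  unfolding von_neumann_algebra_def
proof (intro conjI ballI allI impI subsetI)
  fix S assume S: "S \<in> bipolar G"
  note Sl = bounded_clinearD[OF bipolar_bounded_clinear[OF S]]
  show "bounded_clinear S" by (rule bipolar_bounded_clinear[OF S])
  fix T assume T: "T \<in> bipolar G"
  note Tl = bounded_clinearD[OF bipolar_bounded_clinear[OF T]]
  show "(\<lambda>x. S x + T x) \<in> bipolar G"
  proof (rule bipolarI)
    show "bounded_clinear (\<lambda>x. S x + T x)"
      using Sl(1) Tl(1) by (auto simp: bounded_clinear_def Sl Tl scaleC_add_right intro: bounded_linear_add)
    fix n x y assume *: "\<And>B. B \<in> sets G \<Longrightarrow> (\<Sum>i<n::nat. cinner (E B (x i)) (y i)) = 0"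
    show "(\<Sum>i<n. cinner (S (x i) + T (x i)) (y i)) = 0"
      by (simp add: cinner_add_left sum.distrib bipolarD[OF S *] bipolarD[OF T *])
  qed
  show "(\<lambda>x. S (T x)) \<in> bipolar G"
  proof (rule bipolarI)
    show "bounded_clinear (\<lambda>x. S (T x))"
      using bounded_linear_compose[OF Sl(1) Tl(1)] by (auto simp: bounded_clinear_def Sl Tl)
    fix n x y assume *: "\<And>B. B \<in> sets G \<Longrightarrow> (\<Sum>i<n::nat. cinner (E B (x i)) (y i)) = 0"
    \<comment> \<open>Annihilation is passed on in two rounds:
      \<open>E B (E C u) = E (B \<inter> C) u\<close> lets \<open>T\<close> be applied to the
      vectors \<open>E C (x i)\<close>; moving \<open>E C\<close> past \<open>T\<close> then lets
      \<open>S\<close> be applied to the vectors \<open>T (x i)\<close>.\<close>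
    show "(\<Sum>i<n. cinner (S (T (x i))) (y i)) = 0"
    proof (rule bipolarD[OF S])
      fix C assume C: "C \<in> sets G"
      then have CM: "C \<in> sets M" using G by (auto simp: subalgebra_def)
      have "(\<Sum>i<n. cinner (T (E C (x i))) (y i)) = 0"
      proof (rule bipolarD[OF T])
        fix B assume "B \<in> sets G"
        then have BM: "B \<in> sets M" and "B \<inter> C \<in> sets G" using G C by (auto simp: subalgebra_def)
        then show "(\<Sum>i<n. cinner (E B (E C (x i))) (y i)) = 0"
          using * by (simp add: E_Int[OF BM CM])
      qed
      then show "(\<Sum>i<n. cinner (E C (T (x i))) (y i)) = 0"
        by (simp add: bipolar_commute[OF G T C])
    qed
  qed
next
  show "(\<lambda>x. x) \<in> bipolar G"
  proof (rule bipolarI)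
    fix n and x y :: "nat \<Rightarrow> 'a"
    assume "\<And>B. B \<in> sets G \<Longrightarrow> (\<Sum>i<n. cinner (E B (x i)) (y i)) = 0"
    from this[of "space G"] G show "(\<Sum>i<n. cinner (x i) (y i)) = 0"
      by (simp add: subalgebra_def)
  qed (simp add: bounded_clinear_def bounded_linear_ident)
next
  fix c T assume T: "T \<in> bipolar G"
  note Tl = bounded_clinearD[OF bipolar_bounded_clinear[OF T]]
  show "(\<lambda>x. c *\<^sub>C T x) \<in> bipolar G"
  proof (rule bipolarI)
    show "bounded_clinear (\<lambda>x. c *\<^sub>C T x)"
      using bounded_linear_compose[OF bounded_linear_scaleC_right Tl(1)]
      by (auto simp: bounded_clinear_def Tl scaleC_scaleC mult.commute)
    fix n x y assume *: "\<And>B. B \<in> sets G \<Longrightarrow> (\<Sum>i<n::nat. cinner (E B (x i)) (y i)) = 0"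
    show "(\<Sum>i<n. cinner (c *\<^sub>C T (x i)) (y i)) = 0"
      by (simp add: cinner_scaleC_left bipolarD[OF T *] flip: sum_distrib_left)
  qed
next
  fix S T assume S: "S \<in> bipolar G" and T: "bounded_clinear T \<and> adjoint_pair S T"
  show "T \<in> bipolar G"
  proof (rule bipolarI)
    fix n and x y :: "nat \<Rightarrow> 'a"
    assume *: "\<And>B. B \<in> sets G \<Longrightarrow> (\<Sum>i<n. cinner (E B (x i)) (y i)) = 0"
    have "(\<Sum>i<n. cinner (S (y i)) (x i)) = 0"
    proof (rule bipolarD[OF S])
      fix B assume B: "B \<in> sets G"
      then have BM: "B \<in> sets M" using G by (auto simp: subalgebra_def)
      have "(\<Sum>i<n. cinner (E B (y i)) (x i)) = cnj (\<Sum>i<n. cinner (E B (x i)) (y i))"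
        unfolding cnj_sum by (intro sum.cong refl) (simp add: E_adjoint[OF BM] flip: cinner_commute)
      with *[OF B] show "(\<Sum>i<n. cinner (E B (y i)) (x i)) = 0" by simp
    qed
    then have "cnj (\<Sum>i<n. cinner (y i) (T (x i))) = 0"
      using T by (simp add: adjoint_pair_def)
    then show "(\<Sum>i<n. cinner (T (x i)) (y i)) = 0"
      by (simp flip: cinner_commute)
  qed (use T in simp)
next
  fix T assume T: "T \<in> wot_closure (bipolar G)"
  show "T \<in> bipolar G"
  proof (rule bipolarI)
    show "bounded_clinear T" using T by (simp add: wot_closure_def)
    fix n and x y :: "nat \<Rightarrow> 'a"
    assume *: "\<And>B. B \<in> sets G \<Longrightarrow> (\<Sum>i<n. cinner (E B (x i)) (y i)) = 0"
    let ?s = "\<Sum>i<n. cinner (T (x i)) (y i)"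
    have "cmod ?s \<le> e" if e: "0 < e" for e
    proof -
      \<comment> \<open>The \<open>+ 1\<close> covers \<open>n = 0\<close>.\<close>
      have "0 < e / (real n + 1)" using e by simp
      moreover have "finite ((\<lambda>i. (x i, y i)) ` {..<n})" by simp
      ultimately obtain S where S: "S \<in> bipolar G"
        and close: "\<forall>(u, v)\<in>(\<lambda>i. (x i, y i)) ` {..<n}.
          cmod (cinner (S u) v - cinner (T u) v) < e / (real n + 1)"
        using T unfolding wot_closure_def by blast
      have "cmod ?s = cmod (\<Sum>i<n. cinner (S (x i)) (y i) - cinner (T (x i)) (y i))"
        using bipolarD[OF S *] by (simp add: sum_subtractf)
      also have "\<dots> \<le> (\<Sum>i<n. e / (real n + 1))"
        using close by (intro sum_norm_le) (auto intro: less_imp_le)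
      also have "\<dots> \<le> e"
        using e by (simp add: field_simps)
      finally show ?thesis .
    qed
    then have "cmod ?s \<le> 0"
      by (rule field_le_epsilon) simp
    then show "?s = 0" by simp
  qed
qed

lemma dyadic_annihilated:
  fixes n :: nat
  assumes B: "\<And>k. B k \<in> sets G"
    and v: "\<And>i. i < n \<Longrightarrow> (\<lambda>k. (1/2)^Suc k *\<^sub>R E (B k) (x i)) sums v i"
    and ann: "\<And>B. B \<in> sets G \<Longrightarrow> (\<Sum>i<n. cinner (E B (x i)) (y i)) = 0"
  shows "(\<Sum>i<n. cinner (v i) (y i)) = 0"
proof -
  have "(\<lambda>k. \<Sum>i<n. cinner ((1/2)^Suc k *\<^sub>R E (B k) (x i)) (y i)) sums (\<Sum>i<n. cinner (v i) (y i))"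
    by (intro sums_sum bounded_linear.sums[OF bounded_linear_cinner_left] v) auto
  moreover have "(\<Sum>i<n. cinner ((1/2)^Suc k *\<^sub>R E (B k) (x i)) (y i)) = 0" for k
    using ann[OF B[of k]] by (simp add: cinner_scaleR_left flip: sum_distrib_left del: power_Suc)
  ultimately show ?thesis
    by (simp only: sums_unique2[OF _ sums_zero])
qed

text \<open>The digit sets of a \<open>G\<close>-measurable \<open>h\<close> can be taken in
  \<open>G\<close>, which makes \<open>S\<close> a limit of combinations of projections
  \<open>E B\<close> with \<open>B\<close> in \<open>G\<close>.\<close>

lemma represents_in_bipolar:
  assumes G: "subalgebra M G" and S: "represents h S" and h: "h \<in> borel_measurable G"
  shows "S \<in> bipolar G"
proof -
  obtain B where B: "range B \<subseteq> sets G"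
    "\<And>t. t \<in> space G \<Longrightarrow> (\<lambda>k. (1/2)^Suc k * indicator (B k) t) sums h t"
    using binary_digit_sets[OF h] representsD(2,3)[OF S] G by (auto simp: subalgebra_def)
  then have sums: "(\<lambda>k. (1/2)^Suc k *\<^sub>R E (B k) x) sums S x" for x
    using G by (intro represents_sums[OF S]) (auto simp: subalgebra_def)
  have Bk: "B k \<in> sets G" for k
    using B(1) by auto
  show ?thesis
    by (rule bipolarI[OF representsD(4)[OF S]]) (rule dyadic_annihilated[OF Bk sums])
qed

text \<open>A single finite measure for all the \<open>x i\<close>, so that one conditional
  expectation serves every vector simultaneously.\<close>

definition nu_sum :: "nat \<Rightarrow> (nat \<Rightarrow> 'a) \<Rightarrow> 'b measure" where
  "nu_sum n x = measure_of (space M) (sets M) (\<lambda>B. \<Sum>i<n. emeasure (\<nu> (x i)) B)"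

lemma space_nu_sum [simp]: "space (nu_sum n x) = space M"
  and sets_nu_sum [simp, measurable_cong]: "sets (nu_sum n x) = sets M"
  by (simp_all add: nu_sum_def)

lemma emeasure_nu_sum:
  assumes "B \<in> sets M"
  shows "emeasure (nu_sum n x) B = (\<Sum>i<n. emeasure (\<nu> (x i)) B)"
  unfolding nu_sum_def
proof (rule emeasure_measure_of_sigma)
  show "countably_additive (sets M) (\<lambda>B. \<Sum>i<n. emeasure (\<nu> (x i)) B)"
  proof (rule countably_additiveI)
    fix D :: "nat \<Rightarrow> 'b set"
    assume D: "range D \<subseteq> sets M" "disjoint_family D"
    have "(\<Sum>k. \<Sum>i<n. emeasure (\<nu> (x i)) (D k)) = (\<Sum>i<n. \<Sum>k. emeasure (\<nu> (x i)) (D k))"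
      by (rule suminf_sum) auto
    also have "\<dots> = (\<Sum>i<n. emeasure (\<nu> (x i)) (\<Union>k. D k))"
      using D by (intro sum.cong refl suminf_emeasure) auto
    finally show "(\<Sum>k. \<Sum>i<n. emeasure (\<nu> (x i)) (D k)) = (\<Sum>i<n. emeasure (\<nu> (x i)) (\<Union>k. D k))" .
  qed
qed (use assms in \<open>auto simp: positive_def sets.sigma_algebra_axioms\<close>)

lemma finite_measure_nu_sum: "finite_measure (nu_sum n x)"
  by (rule finite_measureI) (simp add: emeasure_nu_sum emeasure_nu)

lemma measure_nu_sum:
  assumes "B \<in> sets M"
  shows "measure (nu_sum n x) B = (\<Sum>i<n. measure (\<nu> (x i)) B)"
  using assms by (simp add: measure_def emeasure_nu_sum emeasure_nu sum_ennreal sum_nonneg)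

text \<open>Additivity is known for measures of sets; the dyadic series transfers it to
  integrals.\<close>

lemma integral_nu_sum:
  fixes h :: "'b \<Rightarrow> real"
  assumes h: "h \<in> borel_measurable M" "\<And>t. t \<in> space M \<Longrightarrow> 0 \<le> h t \<and> h t \<le> 1"
  shows "(\<integral>t. h t \<partial>nu_sum n x) = (\<Sum>i<n. \<integral>t. h t \<partial>\<nu> (x i))"
proof -
  obtain B where B: "range B \<subseteq> sets M"
    "\<And>t. t \<in> space M \<Longrightarrow> (\<lambda>k. (1/2)^Suc k * indicator (B k) t) sums h t"
    using binary_digit_sets[of h M] h by blast
  have Bk: "B k \<in> sets M" for k using B by auto
  have *: "(\<lambda>k. (1/2)^Suc k * measure N (B k)) sums (\<integral>t. h t \<partial>N)"
    if N: "finite_measure N" "sets N = sets M" for N :: "'b measure"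
  proof -
    have "(\<lambda>k. (1/2)^Suc k * (\<integral>t. indicator (B k) t * 1 \<partial>N)) sums (\<integral>t. h t * 1 \<partial>N)"
      using B N sets_eq_imp_space_eq[OF N(2)]
      by (intro dyadic_integral_sums finite_measure.integrable_const) auto
    then show ?thesis
      using Bk N sets_eq_imp_space_eq[OF N(2)] sets.sets_into_space[OF Bk] by (simp add: Int_absorb2)
  qed
  have "(\<lambda>k. \<Sum>i<n. (1/2)^Suc k * measure (\<nu> (x i)) (B k)) sums (\<Sum>i<n. \<integral>t. h t \<partial>\<nu> (x i))"
    by (intro sums_sum * finite_measure_nu) auto
  then have "(\<lambda>k. (1/2)^Suc k * measure (nu_sum n x) (B k)) sums (\<Sum>i<n. \<integral>t. h t \<partial>\<nu> (x i))"
    by (simp only: measure_nu_sum[OF Bk] sum_distrib_left)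
  with *[OF finite_measure_nu_sum sets_nu_sum] show ?thesis
    by (rule sums_unique2)
qed

section \<open>From membership in the algebra to measurability\<close>

text \<open>
  With \<open>g\<close> the conditional expectation of \<open>f\<close> given \<open>G\<close> and \<open>W = \<integral> g dE\<close>, the vectors
  \<open>y\<^sub>i = (U - W) x\<^sub>i\<close> annihilate \<open>E B\<close> for \<open>B\<close> in \<open>G\<close>, hence also \<open>U\<close> and \<open>W\<close>; so
  \<open>\<Sum>i. \<parallel>(U - W) x\<^sub>i\<parallel>\<^sup>2 = 0\<close>.
\<close>

lemma bipolar_measurable_finite:
  fixes n :: nat
  assumes G: "subalgebra M G" and U: "represents f U" "U \<in> bipolar G"
  obtains g where "g \<in> borel_measurable G" "\<And>i. i < n \<Longrightarrow> AE t in \<nu> (x i). f t = g t"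
proof -
  note f = representsD[OF U(1)]
  have fM [measurable]: "f \<in> borel_measurable M" by (rule f)
  interpret N: finite_measure_subalgebra "nu_sum n x" G
    using G by (auto simp: finite_measure_subalgebra_def finite_measure_subalgebra_axioms_def
        finite_measure_nu_sum subalgebra_def)
  define g0 where "g0 = real_cond_exp (nu_sum n x) G f"
  \<comment> \<open>The conditional expectation lies in \<open>[0, 1]\<close> only almost
    everywhere; clipping keeps it \<open>G\<close>-measurable and makes binary digits available at
    every point.\<close>
  define g where "g t = clip (g0 t)" for t
  have "g0 \<in> borel_measurable G"
    unfolding g0_def by (rule borel_measurable_cond_exp)
  then have gG: "g \<in> borel_measurable G"
    unfolding g_def[abs_def] by measurable
  then have gM [measurable]: "g \<in> borel_measurable M"
    using G measurable_from_subalg by blast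
  have g01: "0 \<le> g t" "g t \<le> 1" for t
    by (auto simp: g_def)
  have int: "integrable (nu_sum n x) f"
    using f by (intro finite_measure.integrable_const_bound[OF finite_measure_nu_sum, where B = 1]) auto
  have "AE t in nu_sum n x. 0 \<le> g0 t" "AE t in nu_sum n x. g0 t \<le> 1"
    unfolding g0_def using f
    by (auto intro!: N.real_cond_exp_ge_c[OF int] N.real_cond_exp_le_c[OF int])
  then have g0: "AE t in nu_sum n x. g0 t = g t"
    by eventually_elim (simp add: g_def clip_id)
  have condexp: "(\<integral>t. indicator B t * f t \<partial>nu_sum n x) = (\<integral>t. indicator B t * g t \<partial>nu_sum n x)"
    if B: "B \<in> sets G" for B
  proof -
    have BM [measurable]: "B \<in> sets M" using B G by (auto simp: subalgebra_def)
    have g0M [measurable]: "g0 \<in> borel_measurable M"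
      using G \<open>g0 \<in> borel_measurable G\<close> measurable_from_subalg by blast
    have "(\<integral>t. indicator B t * f t \<partial>nu_sum n x) = (\<integral>t. indicator B t * g0 t \<partial>nu_sum n x)"
      using N.real_cond_exp_intA[OF int B] by (simp add: set_lebesgue_integral_def g0_def)
    also have "\<dots> = (\<integral>t. indicator B t * g t \<partial>nu_sum n x)"
      using g0 by (intro integral_cong_AE) (auto elim: eventually_mono)
    finally show ?thesis .
  qed
  obtain D where D: "range D \<subseteq> sets G"
    "\<And>t. t \<in> space G \<Longrightarrow> (\<lambda>k. (1/2)^Suc k * indicator (D k) t) sums g t"
    using binary_digit_sets[OF gG] g01 by auto
  have DM: "range D \<subseteq> sets M" "\<And>t. t \<in> space M \<Longrightarrow> (\<lambda>k. (1/2)^Suc k * indicator (D k) t) sums g t"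
    using D G by (auto simp: subalgebra_def)
  \<comment> \<open>The vector \<open>w i\<close> stands for \<open>W (x i)\<close>; the series is
    formed only at these vectors, so no operator has to be built.\<close>
  define w where "w i = (\<Sum>k. (1/2)^Suc k *\<^sub>R E (D k) (x i))" for i
  have w: "(\<lambda>k. (1/2)^Suc k *\<^sub>R E (D k) (x i)) sums w i" for i
    unfolding w_def by (rule summable_sums[OF dyadic_summable[OF DM(1)]])
  define y where "y i = U (x i) - w i" for i
  have ann: "(\<Sum>i<n. cinner (E B (x i)) (y i)) = 0" if B: "B \<in> sets G" for B
  proof -
    have BM [measurable]: "B \<in> sets M" using B G by (auto simp: subalgebra_def)
    have "(\<Sum>i<n. cinner (y i) (E B (x i))) =
        of_real ((\<Sum>i<n. \<integral>t. indicator B t * f t \<partial>\<nu> (x i)) - (\<Sum>i<n. \<integral>t. indicator B t * g t \<partial>\<nu> (x i)))"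
      by (simp add: y_def cinner_diff_left represents_cinner[OF U(1) BM] dyadic_cinner[OF DM BM w]
          sum_subtractf)
    also have "\<dots> = of_real ((\<integral>t. indicator B t * f t \<partial>nu_sum n x) - (\<integral>t. indicator B t * g t \<partial>nu_sum n x))"
      using f g01 by (subst (1 2) integral_nu_sum) (auto simp: indicator_def)
    also have "\<dots> = 0"
      using condexp[OF B] by simp
    finally have "cnj (\<Sum>i<n. cinner (y i) (E B (x i))) = 0"
      by simp
    then show ?thesis
      by (simp flip: cinner_commute)
  qed
  have "(\<Sum>i<n. cinner (U (x i)) (y i)) = 0"
    by (rule bipolarD[OF U(2) ann])
  moreover have "(\<Sum>i<n. cinner (w i) (y i)) = 0"
    by (rule dyadic_annihilated[OF _ w ann]) (use D in auto)
  ultimately have "(\<Sum>i<n. cinner (y i) (y i)) = 0"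
    by (simp add: y_def[of i for i] cinner_diff_left sum_subtractf)
  then have "complex_of_real (\<Sum>i<n. (norm (y i))\<^sup>2) = 0"
    by (simp only: cinner_self of_real_sum)
  then have "(\<Sum>i<n. (norm (y i))\<^sup>2) = 0"
    by (simp only: of_real_eq_0_iff)
  then have y0: "y i = 0" if "i < n" for i
    using that by (simp add: sum_nonneg_eq_0_iff)
  \<comment> \<open>Now \<open>U (x i) = w i\<close>. Testing against \<open>E B\<close> for all
    \<open>B\<close> in \<open>M\<close>, not only in \<open>G\<close>, shows that \<open>f\<close>
    and \<open>g\<close> have the same integral over every measurable set.\<close>
  have "AE t in \<nu> (x i). f t = g t" if i: "i < n" for i
  proof (rule density_unique_real)
    show "integrable (\<nu> (x i)) f" "integrable (\<nu> (x i)) g"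
      using f g01 by (auto intro!: integrable_nu[of _ 1])
    fix B assume "B \<in> sets (\<nu> (x i))"
    then have B: "B \<in> sets M" by simp
    have "complex_of_real (\<integral>t. indicator B t * f t \<partial>\<nu> (x i)) = of_real (\<integral>t. indicator B t * g t \<partial>\<nu> (x i))"
      using represents_cinner[OF U(1) B, of "x i"] dyadic_cinner[OF DM B w, of i] y0[OF i]
      by (simp add: y_def)
    then show "(\<integral>t\<in>B. f t \<partial>\<nu> (x i)) = (\<integral>t\<in>B. g t \<partial>\<nu> (x i))"
      by (simp only: of_real_eq_iff set_lebesgue_integral_def real_scaleR_def)
  qed
  with gG that show ?thesis by blast
qed

text \<open>Along a dense sequence \<open>q\<close>, a function \<open>g n\<close> matches
  \<open>f\<close> for the first \<open>n\<close> vectors. The pointwise limit matches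
  \<open>f\<close> for all of them, and the fixed vectors of a projection form a closed set.\<close>

lemma bipolar_measurable:
  assumes sep: "separable_space (euclidean :: 'a topology)"
    and G: "subalgebra M G" and U: "represents f U" "U \<in> bipolar G"
  obtains g where "g \<in> borel_measurable G" "\<And>x. E {t \<in> space M. f t = g t} x = x"
proof -
  obtain Q :: "'a set" where Q: "countable Q" "closure Q = UNIV"
    using sep by (auto simp: separable_space_def)
  then have "Q \<noteq> {}" by auto
  define q where "q = from_nat_into Q"
  have q: "range q = Q"
    unfolding q_def using Q \<open>Q \<noteq> {}\<close> by (simp add: range_from_nat_into)
  have "\<exists>g. g \<in> borel_measurable G \<and> (\<forall>i<n. AE t in \<nu> (q i). f t = g t)" for n
    by (rule bipolar_measurable_finite[OF G U, of n q]) blast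
  then obtain g where gG [measurable]: "\<And>n. g n \<in> borel_measurable G"
    and g: "\<And>n i. i < n \<Longrightarrow> AE t in \<nu> (q i). f t = g n t"
    by metis
  \<comment> \<open>At almost every point for \<open>\<nu> (q i)\<close> the sequence is constantly
    \<open>f t\<close> from index \<open>Suc i\<close> on, so the limit exists there; elsewhere the
    value of \<open>lim\<close> is immaterial.\<close>
  define h where "h t = lim (\<lambda>n. g n t)" for t
  have hG: "h \<in> borel_measurable G"
    unfolding h_def[abs_def] by measurable
  then have hM [measurable]: "h \<in> borel_measurable M"
    using G measurable_from_subalg by blast
  have [measurable]: "f \<in> borel_measurable M"
    by (rule representsD(1)[OF U(1)])
  have B: "{t \<in> space M. f t = h t} \<in> sets M" (is "?B \<in> _")
    by measurable
  have "E ?B (q i) = q i" for i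
  proof -
    have "AE t in \<nu> (q i). \<forall>n. i < n \<longrightarrow> f t = g n t"
      using g by (auto simp: AE_all_countable)
    then have "AE t in \<nu> (q i). f t = h t"
    proof eventually_elim
      case (elim t)
      have "(\<lambda>n. g n t) \<longlonglongrightarrow> f t"
        by (rule tendsto_eventually) (use elim in \<open>auto simp: eventually_sequentially Suc_le_eq intro!: exI[of _ "Suc i"]\<close>)
      then show ?case
        by (simp add: h_def limI)
    qed
    then show ?thesis
      by (rule AE_nu_iff[OF B, THEN iffD1])
  qed
  then have onQ: "E ?B y = y" if "y \<in> Q" for y
    using that unfolding q[symmetric] by auto
  have "closed {y. E ?B y = y}"
    by (intro closed_Collect_eq continuous_on_id linear_continuous_on E_linear(1)[OF B])
  then have "closure Q \<subseteq> {y. E ?B y = y}"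
    using onQ by (intro closure_minimal) auto
  then have "E ?B x = x" for x
    using Q by auto
  with hG that show ?thesis by blast
qed

end

section \<open>Separation of points\<close>

text \<open>The sets that fail to separate two given points are closed under complements and
  countable unions.\<close>

lemma sigma_sets_not_separating:
  assumes "A \<in> sigma_sets X \<A>" "s \<in> X" "t \<in> X" "\<And>a. a \<in> \<A> \<Longrightarrow> s \<in> a \<longleftrightarrow> t \<in> a"
  shows "s \<in> A \<longleftrightarrow> t \<in> A"
  using assms(1) by induction (use assms(2-4) in auto)

lemma generated_subset:
  assumes "von_neumann_algebra N" "G \<subseteq> N"
  shows "generated_von_neumann_algebra G \<subseteq> N"
  using assms by (auto simp: generated_von_neumann_algebra_def)

lemma generated_contains: "G \<subseteq> generated_von_neumann_algebra G"
  by (auto simp: generated_von_neumann_algebra_def)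

text \<open>Separability enters through \<open>bipolar_measurable\<close>, where a countable dense
  set replaces all vectors.\<close>

theorem theorem3p1:
  fixes F :: "real set \<Rightarrow> 'a::complex_hilbert_space \<Rightarrow> 'a"
    and A :: "'a \<rightharpoonup> 'a"
    and \<mu> :: "real set \<Rightarrow> real \<Rightarrow> real"
    and E :: "real set \<Rightarrow> 'a \<Rightarrow> 'a"
  assumes separable: "separable_space (euclidean :: 'a topology)"
    and povm: "normalized_povm borel F"
    and triplet: "von_neumann_triplet F A \<mu>"
    and sharp: "sharp_version A F"
    and spectral: "spectral_measure_of A E"
  shows "\<exists>\<Gamma>. \<Gamma> \<subseteq> real_spectrum A \<and> \<Gamma> \<in> sets (spectrum_space A) \<and> E \<Gamma> = (\<lambda>x. x) \<and>
           (\<forall>s\<in>\<Gamma>. \<forall>t\<in>\<Gamma>. s \<noteq> t \<longrightarrow> (\<exists>\<Delta>\<in>sets borel. \<mu> \<Delta> s \<noteq> \<mu> \<Delta> t))"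
proof -
  obtain T where T: "bounded_clinear T" and A: "A = (\<lambda>x. Some (T x))"
    and gen: "generated_von_neumann_algebra {T} = generated_von_neumann_algebra (F ` sets borel)"
    using sharp by (auto simp: sharp_version_def)
  obtain E' where E': "spectral_measure_of A E'"
    and kernel: "markov_kernel (real_spectrum A) \<mu> \<or> weak_markov_kernel (real_spectrum A) E' \<mu>"
    and F': "\<And>\<Delta>. \<Delta> \<in> sets borel \<Longrightarrow>
      is_spectral_integral (spectrum_space A) E' (\<mu> \<Delta>) (\<lambda>x. Some (F \<Delta> x))"
    using triplet by (auto simp: von_neumann_triplet_def)
  have kmap: "kernel_map (real_spectrum A) \<mu>"
    using kernel by (auto simp: markov_kernel_def weak_markov_kernel_def)
  interpret projection_valued "spectrum_space A" E
    using spectral by unfold_locales (simp add: spectral_measure_of_def)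
  interpret E': projection_valued "spectrum_space A" E'
    using E' by unfold_locales (simp add: spectral_measure_of_def)
  let ?M = "spectrum_space A"
  have space: "space ?M = real_spectrum A"
    by (simp add: space_restrict_space)
  \<comment> \<open>The triplet brings its own spectral measure \<open>E'\<close>; equality of the
    scalar measures moves the representation of \<open>F\<close> to the given
    \<open>E\<close>.\<close>
  have "\<nu> x = E'.\<nu> x" for x
  proof (rule measure_eqI)
    fix B assume "B \<in> sets (\<nu> x)"
    then have B: "B \<in> sets ?M" by simp
    have "E B x = E' B x"
      using spectral_measure_of_unique[OF T, of E E' B x] spectral E' B by (simp add: A)
    then show "emeasure (\<nu> x) B = emeasure (E'.\<nu> x) B"
      by (simp add: emeasure_nu[OF B] E'.emeasure_nu[OF B])
  qed simp
  then have F: "is_spectral_integral ?M E (\<mu> \<Delta>) (\<lambda>x. Some (F \<Delta> x))" if "\<Delta> \<in> sets borel" for \<Delta>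
    using F'[OF that] by (simp add: is_spectral_integral_def)
  have F_rep: "represents (\<mu> \<Delta>) (F \<Delta>)" if \<Delta>: "\<Delta> \<in> sets borel" for \<Delta>
    unfolding represents_def
  proof (intro conjI allI)
    show "\<mu> \<Delta> \<in> borel_measurable ?M" "\<forall>t\<in>space ?M. 0 \<le> \<mu> \<Delta> t \<and> \<mu> \<Delta> t \<le> 1"
      using kmap \<Delta> by (auto simp: kernel_map_def space)
    show "bounded_clinear (F \<Delta>)"
      using povm \<Delta> by (simp add: normalized_povm_def povm_def positive_operator_def)
    show "cinner (F \<Delta> x) x = of_real (\<integral>t. \<mu> \<Delta> t \<partial>\<nu> x)" for x
      using F[OF \<Delta>] by (simp add: is_spectral_integral_def)
  qed
  define gens where "gens = {\<mu> \<Delta> -` B \<inter> space ?M | \<Delta> B. \<Delta> \<in> sets borel \<and> B \<in> sets borel}"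
  define G where "G = sigma (space ?M) gens"
  have gens: "gens \<subseteq> Pow (space ?M)"
    by (auto simp: gens_def)
  have "gens \<subseteq> sets ?M"
    using representsD(1)[OF F_rep] by (auto simp: gens_def intro: measurable_sets)
  then have sub: "subalgebra ?M G"
    using gens by (auto simp: subalgebra_def G_def space_measure_of_conv sets_measure_of
        intro!: sets.sigma_sets_subset)
  have F_bip: "F \<Delta> \<in> bipolar G" if \<Delta>: "\<Delta> \<in> sets borel" for \<Delta>
  proof (rule represents_in_bipolar[OF sub F_rep[OF \<Delta>]])
    show "\<mu> \<Delta> \<in> borel_measurable G"
    proof (rule measurableI)
      fix B :: "real set" assume "B \<in> sets borel"
      then have "\<mu> \<Delta> -` B \<inter> space ?M \<in> gens"
        using \<Delta> by (auto simp: gens_def)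
      then show "\<mu> \<Delta> -` B \<inter> space G \<in> sets G"
        using gens by (auto simp: G_def space_measure_of_conv sets_measure_of)
    qed simp
  qed
  have vna: "von_neumann_algebra (bipolar G)"
    by (rule von_neumann_algebra_bipolar[OF sub])
  have T_bip: "T \<in> bipolar G"
  proof -
    \<comment> \<open>Sharpness enters here: \<open>T\<close> belongs to the algebra generated by
      the operators \<open>F \<Delta>\<close>.\<close>
    have "T \<in> generated_von_neumann_algebra (F ` sets borel)"
      unfolding gen[symmetric] using generated_contains[of "{T}"] by simp
    moreover have "generated_von_neumann_algebra (F ` sets borel) \<subseteq> bipolar G"
      by (rule generated_subset[OF vna]) (use F_bip in auto)
    ultimately show ?thesis by blast
  qed
  obtain K where K: "\<And>x. norm (T x) \<le> K * norm x" "0 < K"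
    using bounded_linear.pos_bounded[OF bounded_clinearD(1)[OF T]] by (auto simp: mult.commute)
  define f where "f t = clip ((t + K) / (2 * K))" for t
  have f_rep: "represents f (rescaled K T)"
    using rescaled_represents[OF T spectral[unfolded A] K] unfolding f_def A .
  have f_bip: "rescaled K T \<in> bipolar G"
  proof -
    have id: "(\<lambda>x. x) \<in> bipolar G"
      and add: "\<And>S T. S \<in> bipolar G \<Longrightarrow> T \<in> bipolar G \<Longrightarrow> (\<lambda>x. S x + T x) \<in> bipolar G"
      and scale: "\<And>c T. T \<in> bipolar G \<Longrightarrow> (\<lambda>x. c *\<^sub>C T x) \<in> bipolar G"
      using vna unfolding von_neumann_algebra_def by blast+
    \<comment> \<open>Real scalars are rewritten as complex ones to match the closure properties of
      the algebra.\<close>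
    have "rescaled K T = (\<lambda>x. of_real (1 / (2 * K)) *\<^sub>C (T x + of_real K *\<^sub>C x))"
      unfolding rescaled_def[abs_def] scaleC_of_real ..
    then show ?thesis
      using scale[OF add[OF T_bip scale[OF id]]] by simp
  qed
  obtain g where g: "g \<in> borel_measurable G" and fg: "\<And>x. E {t \<in> space ?M. f t = g t} x = x"
    by (rule bipolar_measurable[OF separable sub f_rep f_bip]) blast
  define R where "R = {t \<in> real_spectrum A. \<bar>t\<bar> \<le> K}"
  \<comment> \<open>Intersecting with \<open>R\<close> keeps only points where clipping is inactive,
    so that \<open>f\<close> is injective on \<open>\<Gamma>\<close>.\<close>
  define \<Gamma> where "\<Gamma> = {t \<in> space ?M. f t = g t} \<inter> R"
  have [measurable]: "(\<lambda>t. t) \<in> borel_measurable ?M" "f \<in> borel_measurable ?M" "g \<in> borel_measurable ?M"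
    using representsD(1)[OF f_rep] measurable_from_subalg[OF sub g]
    by (auto intro: measurable_restrict_space1)
  have "R = {t \<in> space ?M. \<bar>t\<bar> \<le> K}"
    by (simp add: R_def space)
  then have sets: "{t \<in> space ?M. f t = g t} \<in> sets ?M" "R \<in> sets ?M"
    by simp_all
  have "E R x = x" for x
    using spectral_measure_of_bounded(1)[OF spectral[unfolded A] K(1)] by (simp add: R_def A)
  then have "E \<Gamma> = (\<lambda>x. x)"
    using fg by (simp add: fun_eq_iff \<Gamma>_def E_Int[OF sets, symmetric])
  moreover have "\<Gamma> \<subseteq> real_spectrum A" "\<Gamma> \<in> sets ?M"
    using sets by (auto simp: \<Gamma>_def R_def)
  moreover have "\<exists>\<Delta>\<in>sets borel. \<mu> \<Delta> s \<noteq> \<mu> \<Delta> t" if st: "s \<in> \<Gamma>" "t \<in> \<Gamma>" "s \<noteq> t" for s t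
  proof (rule ccontr)
    assume "\<not> ?thesis"
    then have eq: "\<mu> \<Delta> s = \<mu> \<Delta> t" if "\<Delta> \<in> sets borel" for \<Delta>
      using that by blast
    have in_space: "s \<in> space ?M" "t \<in> space ?M"
      using st by (auto simp: \<Gamma>_def)
    \<comment> \<open>The level set of \<open>g\<close> through \<open>s\<close> belongs to
      \<open>G\<close>, so it also contains the unseparated point \<open>t\<close>.\<close>
    have "g -` {g s} \<inter> space G \<in> sets G"
      by (rule measurable_sets[OF g]) simp
    then have "g -` {g s} \<inter> space ?M \<in> sigma_sets (space ?M) gens"
      using gens by (simp add: G_def space_measure_of_conv sets_measure_of)
    then have "s \<in> g -` {g s} \<inter> space ?M \<longleftrightarrow> t \<in> g -` {g s} \<inter> space ?M"
      by (rule sigma_sets_not_separating[OF _ in_space]) (use eq in_space in \<open>auto simp: gens_def\<close>)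
    then have "g s = g t"
      using in_space by simp
    then have "f s = f t"
      using st by (simp add: \<Gamma>_def)
    moreover have "f u = (u + K) / (2 * K)" if "u \<in> \<Gamma>" for u
      unfolding f_def using that K(2)
      by (intro clip_id) (auto simp: \<Gamma>_def R_def field_simps abs_le_iff)
    ultimately show False
      using st K(2) by simp
  qed
  ultimately show ?thesis by blast
qed

end
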